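(* Let $g\in H(\mathbb{D})$ and $0<p<\infty$, and suppose that $S_g\colon H^p\to H^p$ is bounded. Then the spectrum of $S_g\colon H^p\to H^p$ is $\sigma(S_g)=\{0\}\cup\overline{g(\mathbb{D})}$.
   Context: $\mathbb{D}$ is the open unit disk in $\mathbb{C}$, $H(\mathbb{D})$ is the space of analytic functions on $\mathbb{D}$, and $m$ is the normalized Lebesgue measure on $\partial\mathbb{D}$. For $0<p<\infty$, the Hardy space $H^p$ consists of all $f\in H(\mathbb{D})$ with $\|f\|_{H^p}=\left(\lim_{r\to1^-}\int_{\partial\mathbb{D}}|f(r\xi)|^p\,dm(\xi)\right)^{1/p}<\infty$. For $g\in H(\mathbb{D})$, the Volterra type operator $S_g$ is defined by $(S_gf)(z)=\int_0^z f'(\omega)g(\omega)\,d\omega$ for $z\in\mathbb{D}$, $f\in H(\mathbb{D})$. As usual (also in the quasi-Banach range $0<p<1$), $\sigma(S_g)$ is the set of $\lambda\in\mathbb{C}$ such that $\lambda I-S_g$ does not have a bounded inverse on $H^p$. $\overline{g(\mathbb{D})}$ is the closure in $\mathbb{C}$ of the image of $g$. *)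

theory Defs
  imports "HOL-Complex_Analysis.Complex_Analysis"
begin

abbreviation unit_disc :: "complex set" where
  "unit_disc \<equiv> ball 0 1"

text \<open>Normalized Lebesgue measure on the unit circle, as a Borel measure on the plane.\<close>

definition circle_measure :: "complex measure" where
  "circle_measure = distr (uniform_measure lborel {0..2 * pi}) borel cis"

text \<open>Analytic functions on the disc are represented by total functions that vanish off the
  disc, so that two of them are equal in HOL iff they agree on the disc.\<close>

definition disc_analytic :: "(complex \<Rightarrow> complex) set" where
  "disc_analytic = {f. f holomorphic_on unit_disc \<and> (\<forall>z. z \<notin> unit_disc \<longrightarrow> f z = 0)}"

definition integral_mean :: "real \<Rightarrow> (complex \<Rightarrow> complex) \<Rightarrow> real \<Rightarrow> real" where
  "integral_mean p f r = (LINT \<xi>|circle_measure. norm (f (of_real r * \<xi>)) powr p)"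

text \<open>The integral means increase with the radius, so the limit always exists in the extended
  reals; it is finite iff there is a real limit.\<close>

definition hardy_space :: "real \<Rightarrow> (complex \<Rightarrow> complex) set" where
  "hardy_space p =
    {f \<in> disc_analytic. \<exists>L. (integral_mean p f \<longlongrightarrow> L) (at_left 1)}"

definition hardy_norm :: "real \<Rightarrow> (complex \<Rightarrow> complex) \<Rightarrow> real" where
  "hardy_norm p f = Lim (at_left 1) (integral_mean p f) powr (1 / p)"

definition volterra_S :: "(complex \<Rightarrow> complex) \<Rightarrow> (complex \<Rightarrow> complex) \<Rightarrow> complex \<Rightarrow> complex" where
  "volterra_S g f z =
    (if z \<in> unit_disc then contour_integral (linepath 0 z) (\<lambda>w. deriv f w * g w) else 0)"

definition hardy_bounded_operator ::
    "real \<Rightarrow> ((complex \<Rightarrow> complex) \<Rightarrow> complex \<Rightarrow> complex) \<Rightarrow> bool" where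
  "hardy_bounded_operator p T \<longleftrightarrow>
    (\<forall>f \<in> hardy_space p. T f \<in> hardy_space p) \<and>
    (\<forall>f \<in> hardy_space p. \<forall>h \<in> hardy_space p. T (\<lambda>z. f z + h z) = (\<lambda>z. T f z + T h z)) \<and>
    (\<forall>f \<in> hardy_space p. \<forall>c. T (\<lambda>z. c * f z) = (\<lambda>z. c * T f z)) \<and>
    (\<exists>C. \<forall>f \<in> hardy_space p. hardy_norm p (T f) \<le> C * hardy_norm p f)"

definition hardy_spectrum ::
    "real \<Rightarrow> ((complex \<Rightarrow> complex) \<Rightarrow> complex \<Rightarrow> complex) \<Rightarrow> complex set" where
  "hardy_spectrum p T =
    {l. \<not> (\<exists>R. hardy_bounded_operator p R \<and>
              (\<forall>f \<in> hardy_space p.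
                R (\<lambda>z. l * f z - T f z) = f \<and> (\<lambda>z. l * R f z - T (R f) z) = f))}"

end

(* For l outside {0} and the closure of g(D), solving l f - S_g f = h gives f(0) = h(0) / l and
   f' = h' / (l - g), so the inverse is h(0) / l plus S_G with G = 1 / (l - g) bounded. That a bounded
   symbol G gives a bounded S_G is proved without square functions: if |F'| <= |f'| and F(0) = 0, then
   a suitable combination of powers of |f|^2 and |f|^2 + |F|^2 is subharmonic, and comparing its
   circle means with its value at the centre bounds the means of |F|^p by those of |f|^p.
   Conversely, if R is a bounded inverse of l - S_g, then h_n = R^n(z) satisfies
   (l - g)^n h_n' = 1, while |h_n'(z)| grows at most geometrically in n with a ratio independent of z;
   hence |l - g| is bounded below on the disc. This needs no completeness of H^p. For l = 0 note that
   S_g f vanishes at 0. *)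

theory Submission
  imports Defs
begin

text \<open>The Laplacian of \<open>|f|^2\<close> is \<open>4 |f'|^2\<close>, and that of
  \<open>|f|^2 + |F|^2\<close> is \<open>4 (|f'|^2 + |F'|^2)\<close>. So
  \<open>|F'| \<le> |f'|\<close> compares Laplacians, although it says nothing about the sizes of
  \<open>|f|\<close> and \<open>|F|\<close>. With \<open>s = p / 2\<close>, the Laplacian of
  \<open>(|f|^2 + |F|^2)^s\<close> carries the weight \<open>(|f|^2 + |F|^2)^(s-1)\<close>. For
  \<open>s \<le> 1\<close> this is at most \<open>|f|^(2s-2)\<close>, and a multiple of
  \<open>|f|^(2s)\<close> compensates. For \<open>s > 1\<close> it is far larger wherever
  \<open>|F|\<close> exceeds \<open>|f|\<close>, which forces a mixed term into the combination.
  Zeros spoil the smoothness of such powers, so a constant \<open>e > 0\<close> is added inside and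
  removed by \<open>e -> 0\<close> after integration. The coordinate
  \<open>exp (t + i theta)\<close> turns circles into vertical segments and needs no polar form of
  the Laplacian; the price is that the centre is reached only as \<open>t\<close> tends to minus
  infinity. A second obstacle is the range \<open>p < 1\<close>, where Cauchy's formula alone does
  not bound point values by the means of \<open>|f|^p\<close>.\<close>

section \<open>Directional derivatives up to order two on the left half plane\<close>

abbreviation left_half :: "complex set" where
  "left_half \<equiv> {z. Re z < 0}"

text \<open>\<open>u1\<close> and \<open>u2\<close> are the first and second derivatives of \<open>u\<close> in the direction \<open>d\<close>. The left half
  plane is the punctured disc in logarithmic coordinates.\<close>

definition has_jet ::
    "complex \<Rightarrow> (complex \<Rightarrow> real) \<Rightarrow> (complex \<Rightarrow> real) \<Rightarrow> (complex \<Rightarrow> real) \<Rightarrow> bool" where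
  "has_jet d u u1 u2 \<longleftrightarrow>
    continuous_on left_half u \<and> continuous_on left_half u1 \<and> continuous_on left_half u2 \<and>
    (\<forall>z\<in>left_half. ((\<lambda>h. u (z + of_real h * d)) has_real_derivative u1 z) (at 0) \<and>
                  ((\<lambda>h. u1 (z + of_real h * d)) has_real_derivative u2 z) (at 0))"

lemma open_left_half: "open left_half"
  by (simp add: open_halfspace_Re_lt)

lemma has_jet_const: "has_jet d (\<lambda>_. c) (\<lambda>_. 0) (\<lambda>_. 0)"
  by (simp add: has_jet_def)

lemma has_jet_add:
  assumes "has_jet d u u1 u2" "has_jet d v v1 v2"
  shows "has_jet d (\<lambda>z. u z + v z) (\<lambda>z. u1 z + v1 z) (\<lambda>z. u2 z + v2 z)"
  using assms unfolding has_jet_def by (auto intro!: continuous_intros derivative_intros)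

lemma has_jet_cmult:
  assumes "has_jet d u u1 u2"
  shows "has_jet d (\<lambda>z. c * u z) (\<lambda>z. c * u1 z) (\<lambda>z. c * u2 z)"
  using assms unfolding has_jet_def by (auto intro!: continuous_intros DERIV_cmult)

lemma has_jet_mult:
  assumes "has_jet d u u1 u2" "has_jet d v v1 v2"
  shows "has_jet d (\<lambda>z. u z * v z) (\<lambda>z. u1 z * v z + u z * v1 z)
    (\<lambda>z. u2 z * v z + 2 * (u1 z * v1 z) + u z * v2 z)"
proof -
  have "((\<lambda>h. u (z + of_real h * d) * v (z + of_real h * d)) has_real_derivative
          u1 z * v z + u z * v1 z) (at 0) \<and>
        ((\<lambda>h. u1 (z + of_real h * d) * v (z + of_real h * d) +
              u (z + of_real h * d) * v1 (z + of_real h * d)) has_real_derivative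
          u2 z * v z + 2 * (u1 z * v1 z) + u z * v2 z) (at 0)" if "z \<in> left_half" for z
    using assms that unfolding has_jet_def
    by (auto intro!: derivative_eq_intros elim!: ballE[of _ _ z])
  then show ?thesis
    using assms unfolding has_jet_def by (auto intro!: continuous_intros)
qed

lemma has_jet_powr:
  assumes "has_jet d u u1 u2" and pos: "\<And>z. z \<in> left_half \<Longrightarrow> 0 < u z"
  shows "has_jet d (\<lambda>z. u z powr s) (\<lambda>z. s * u z powr (s - 1) * u1 z)
    (\<lambda>z. s * (s - 1) * u z powr (s - 2) * (u1 z)\<^sup>2 + s * u z powr (s - 1) * u2 z)"
proof -
  have "((\<lambda>h. u (z + of_real h * d) powr s) has_real_derivative
          s * u z powr (s - 1) * u1 z) (at 0) \<and>
        ((\<lambda>h. s * u (z + of_real h * d) powr (s - 1) * u1 (z + of_real h * d)) has_real_derivative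
          s * (s - 1) * u z powr (s - 2) * (u1 z)\<^sup>2 + s * u z powr (s - 1) * u2 z) (at 0)"
    if z: "z \<in> left_half" for z
  proof -
    have d1: "((\<lambda>h. u (z + of_real h * d)) has_real_derivative u1 z) (at 0)"
     and d2: "((\<lambda>h. u1 (z + of_real h * d)) has_real_derivative u2 z) (at 0)"
      using assms z unfolding has_jet_def by auto
    have P: "((\<lambda>h. u (z + of_real h * d) powr r) has_real_derivative
          r * u z powr (r - 1) * u1 z) (at 0)" for r
      using DERIV_chain2[OF _ d1, of "\<lambda>x. x powr r" "r * u z powr (r - 1)"] pos[OF z]
      by (auto intro: has_real_derivative_powr)
    show ?thesis
      using DERIV_mult[OF DERIV_cmult[OF P[of "s - 1"], of s] d2]
      by (intro conjI P) (simp add: power2_eq_square algebra_simps)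
  qed
  then show ?thesis
    using assms unfolding has_jet_def by (force intro!: continuous_intros)
qed

lemma Re_cnj_mult_has_derivative:
  assumes "(a has_vector_derivative a') (at x)" "(b has_vector_derivative b') (at x)"
  shows "((\<lambda>h. Re (cnj (a h) * b h)) has_real_derivative Re (cnj a' * b x + cnj (a x) * b')) (at x)"
proof -
  have "((\<lambda>h. cnj (a h) * b h) has_vector_derivative cnj (a x) * b' + cnj a' * b x) (at x)"
    using has_vector_derivative_mult[OF has_vector_derivative_cnj[OF assms(1)] assms(2)] .
  then show ?thesis
    unfolding has_real_derivative_iff_has_vector_derivative
    by (subst add.commute) (rule bounded_linear.has_vector_derivative[OF bounded_linear_Re])
qed

text \<open>The term with the second derivative of \<open>f\<close> has no sign. It cancels when the
  directions \<open>1\<close> and \<open>\<i>\<close> are added, since \<open>d * d\<close> is then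
  \<open>1\<close> and \<open>-1\<close>.\<close>

lemma has_jet_norm_square:
  assumes "f holomorphic_on left_half"
  shows "has_jet d (\<lambda>z. (norm (f z))\<^sup>2) (\<lambda>z. 2 * Re (cnj (f z) * (deriv f z * d)))
    (\<lambda>z. 2 * (norm (deriv f z * d))\<^sup>2 + 2 * Re (cnj (f z) * (deriv (deriv f) z * d * d)))"
proof -
  have hol: "deriv f holomorphic_on left_half" "deriv (deriv f) holomorphic_on left_half"
    using assms by (auto intro!: holomorphic_deriv open_left_half)
  have ns: "(norm w)\<^sup>2 = Re (cnj w * w)" for w
    by (simp add: cmod_power2) (simp add: power2_eq_square)
  have V: "((\<lambda>h. k (z + of_real h * d)) has_vector_derivative deriv k z * d) (at 0)"
    if "k holomorphic_on left_half" "z \<in> left_half" for k z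
  proof -
    have "(k has_field_derivative deriv k z) (at (z + of_real 0 * d))"
      using holomorphic_derivI[OF that(1) open_left_half that(2)] by simp
    moreover have "((\<lambda>h. z + of_real h * d) has_vector_derivative d) (at 0)"
      by (auto intro!: derivative_eq_intros)
    ultimately show ?thesis
      using field_vector_diff_chain_at[of "\<lambda>h. z + of_real h * d" d 0 k "deriv k z"]
      by (simp add: o_def mult.commute)
  qed
  have D: "((\<lambda>h. (norm (f (z + of_real h * d)))\<^sup>2) has_real_derivative
          2 * Re (cnj (f z) * (deriv f z * d))) (at 0) \<and>
        ((\<lambda>h. 2 * Re (cnj (f (z + of_real h * d)) * (deriv f (z + of_real h * d) * d)))
          has_real_derivative
          2 * (norm (deriv f z * d))\<^sup>2 + 2 * Re (cnj (f z) * (deriv (deriv f) z * d * d))) (at 0)"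
    if z: "z \<in> left_half" for z
  proof
    show "((\<lambda>h. (norm (f (z + of_real h * d)))\<^sup>2) has_real_derivative
          2 * Re (cnj (f z) * (deriv f z * d))) (at 0)"
      unfolding ns
      by (rule DERIV_cong[OF Re_cnj_mult_has_derivative[OF V[OF assms z] V[OF assms z]]])
        (simp add: algebra_simps)
    have "((\<lambda>h. deriv f (z + of_real h * d) * d) has_vector_derivative
            deriv (deriv f) z * d * d) (at 0)"
      using V[OF hol(1) z] by (rule has_vector_derivative_mult_left)
    then show "((\<lambda>h. 2 * Re (cnj (f (z + of_real h * d)) * (deriv f (z + of_real h * d) * d)))
          has_real_derivative
          2 * (norm (deriv f z * d))\<^sup>2 + 2 * Re (cnj (f z) * (deriv (deriv f) z * d * d))) (at 0)"
      unfolding ns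
      by (intro DERIV_cong[OF DERIV_cmult[OF Re_cnj_mult_has_derivative[OF V[OF assms z]]]])
        (auto simp: algebra_simps)
  qed
  have "continuous_on left_half f" "continuous_on left_half (deriv f)"
    "continuous_on left_half (deriv (deriv f))"
    using assms hol by (auto intro: holomorphic_on_imp_continuous_on)
  then show ?thesis
    unfolding has_jet_def using D by (auto intro!: continuous_intros)
qed

section \<open>Circle means as integrals over vertical segments\<close>

definition line_integral :: "(complex \<Rightarrow> real) \<Rightarrow> real \<Rightarrow> real" where
  "line_integral u t = integral {0..2 * pi} (\<lambda>\<theta>. u (Complex t \<theta>))"

lemma continuous_on_line:
  assumes "continuous_on left_half u" "t < 0"
  shows "continuous_on A (\<lambda>\<theta>. u (Complex t \<theta>))"
  by (rule continuous_on_compose2[OF assms(1)])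
    (use assms(2) in \<open>auto simp: Complex_eq intro!: continuous_intros\<close>)

lemma line_integral_has_derivative:
  assumes "continuous_on left_half u" "continuous_on left_half u1" "t < 0"
    and D: "\<And>z. z \<in> left_half \<Longrightarrow> ((\<lambda>h. u (z + of_real h)) has_real_derivative u1 z) (at 0)"
  shows "(line_integral u has_real_derivative line_integral u1 t) (at t)"
proof -
  have "((\<lambda>x. integral (cbox 0 (2 * pi)) (\<lambda>\<theta>. u (Complex x \<theta>))) has_field_derivative
          integral (cbox 0 (2 * pi)) (\<lambda>\<theta>. u1 (Complex t \<theta>))) (at t within {..<0})"
  proof (rule leibniz_rule_field_derivative)
    fix x \<theta> :: real assume x: "x \<in> {..<0}"
    have "((\<lambda>h. u (Complex x \<theta> + of_real h)) has_real_derivative u1 (Complex x \<theta>)) (at 0)"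
      using D x by simp
    then have "((\<lambda>h. u (Complex (h + x) \<theta>)) has_real_derivative u1 (Complex x \<theta>)) (at 0)"
      by (simp add: Complex_eq algebra_simps)
    then have "((\<lambda>y. u (Complex y \<theta>)) has_real_derivative u1 (Complex x \<theta>)) (at (0 + x))"
      by (simp only: DERIV_shift)
    then show "((\<lambda>y. u (Complex y \<theta>)) has_real_derivative u1 (Complex x \<theta>)) (at x within {..<0})"
      by (simp add: has_field_derivative_at_within)
  next
    show "continuous_on ({..<0} \<times> cbox 0 (2 * pi)) (\<lambda>(x, \<theta>). u1 (Complex x \<theta>))"
      unfolding split_beta
      by (rule continuous_on_compose2[OF assms(2)]) (auto simp: Complex_eq intro!: continuous_intros)
  qed (use assms in \<open>auto intro!: integrable_continuous_interval continuous_on_line\<close>)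
  then show ?thesis
    using \<open>t < 0\<close> by (simp add: line_integral_def[abs_def] at_within_open[of t "{..<0}"])
qed

text \<open>The form \<open>w (exp z)\<close> encodes periodicity in the imaginary direction, and
  the integral of a derivative of a periodic function over a period vanishes.\<close>

lemma line_integral_second_imaginary_derivative:
  assumes J: "has_jet \<i> (\<lambda>z. w (exp z)) b1 b2" and t: "t < 0"
  shows "line_integral b2 t = 0"
proof -
  have D: "((\<lambda>x. w (exp (Complex t x))) has_real_derivative b1 (Complex t \<theta>)) (at \<theta>)"
          "((\<lambda>x. b1 (Complex t x)) has_real_derivative b2 (Complex t \<theta>)) (at \<theta>)" for \<theta>
  proof -
    have c: "Complex t \<theta> + of_real h * \<i> = Complex t (h + \<theta>)" for h
      by (simp add: complex_eq_iff)
    have "Complex t \<theta> \<in> left_half"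
      using t by simp
    then have "((\<lambda>h. w (exp (Complex t (h + \<theta>)))) has_real_derivative b1 (Complex t \<theta>)) (at 0)"
         "((\<lambda>h. b1 (Complex t (h + \<theta>))) has_real_derivative b2 (Complex t \<theta>)) (at 0)"
      using J by (simp_all only: has_jet_def c[symmetric])
    then show "((\<lambda>x. w (exp (Complex t x))) has_real_derivative b1 (Complex t \<theta>)) (at \<theta>)"
          "((\<lambda>x. b1 (Complex t x)) has_real_derivative b2 (Complex t \<theta>)) (at \<theta>)"
      using DERIV_shift[of "\<lambda>x. w (exp (Complex t x))" "b1 (Complex t \<theta>)" 0 \<theta>]
        DERIV_shift[of "\<lambda>x. b1 (Complex t x)" "b2 (Complex t \<theta>)" 0 \<theta>] by simp_all
  qed
  have "exp (Complex t (h + 2 * pi)) = exp (Complex t h)" for h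
  proof -
    have "Complex t (h + 2 * pi) = Complex t h + of_real (2 * pi) * \<i>"
      by (simp add: complex_eq_iff)
    then show ?thesis by (simp add: exp_add mult.commute exp_two_pi_i')
  qed
  \<comment> \<open>Periodicity is known for \<open>w (exp z)\<close> only. It passes to
    \<open>b1\<close> because the values at \<open>2 * pi\<close> and at \<open>0\<close> are
    derivatives at \<open>0\<close> of one and the same function.\<close>
  then have "((\<lambda>x. w (exp (Complex t x))) has_real_derivative b1 (Complex t (2 * pi))) (at 0)"
    using D(1)[of "2 * pi"] DERIV_shift[of "\<lambda>x. w (exp (Complex t x))" "b1 (Complex t (2 * pi))" 0 "2 * pi"]
    by simp
  then have "b1 (Complex t (2 * pi)) = b1 (Complex t 0)"
    using D(1)[of 0] DERIV_unique by blast
  moreover have "((\<lambda>\<theta>. b2 (Complex t \<theta>)) has_integral b1 (Complex t (2 * pi)) - b1 (Complex t 0)) {0..2 * pi}"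
    using D(2) by (intro fundamental_theorem_of_calculus)
      (simp_all add: has_real_derivative_iff_has_vector_derivative
        has_vector_derivative_at_within)
  ultimately show ?thesis
    by (simp add: line_integral_def integral_unique)
qed

lemma line_integral_tendsto:
  assumes "isCont w 0" "continuous_on left_half (\<lambda>z. w (exp z))"
  shows "(line_integral (\<lambda>z. w (exp z)) \<longlongrightarrow> 2 * pi * w 0) at_bot"
proof (rule tendstoI)
  fix e :: real assume "0 < e"
  \<comment> \<open>The integral runs over length \<open>2 * pi\<close>, which is less than
    8.\<close>
  then obtain d where d: "0 < d" "\<And>z. norm z < d \<Longrightarrow> \<bar>w z - w 0\<bar> < e / 8"
    using assms(1) unfolding continuous_at_eps_delta
    by (metis dist_norm diff_zero zero_less_divide_iff zero_less_numeral real_norm_def)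
  have "eventually (\<lambda>t. t < min 0 (ln d)) at_bot"
    by (rule eventually_gt_at_bot)
  then show "eventually (\<lambda>t. dist (line_integral (\<lambda>z. w (exp z)) t) (2 * pi * w 0) < e) at_bot"
  proof eventually_elim
    case (elim t)
    then have td: "exp t < d" using d(1)
      by (metis exp_less_mono exp_ln min_less_iff_conj)
    have int: "(\<lambda>\<theta>. w (exp (Complex t \<theta>))) integrable_on {0..2 * pi}"
      using elim by (intro integrable_continuous_interval continuous_on_line[OF assms(2)]) auto
    have "line_integral (\<lambda>z. w (exp z)) t - 2 * pi * w 0
      = integral {0..2 * pi} (\<lambda>\<theta>. w (exp (Complex t \<theta>)) - w 0)"
      using int by (subst integral_diff) (auto simp: line_integral_def)
    moreover have "norm (integral {0..2 * pi} (\<lambda>\<theta>. w (exp (Complex t \<theta>)) - w 0)) \<le> e / 8 * (2 * pi - 0)"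
      using d(2) td
      by (intro integral_bound continuous_intros continuous_on_line[OF assms(2)])
        (use elim in \<open>auto intro!: less_imp_le\<close>)
    moreover have "e / 8 * (2 * pi - 0) < e"
      using \<open>0 < e\<close> pi_less_4 by (simp add: field_simps)
    ultimately show ?case by (simp add: dist_norm)
  qed
qed

text \<open>In logarithmic coordinates the Laplacian splits into a radial and an angular second
  derivative; the latter integrates to zero over a period, so that the mean is a convex function
  of the logarithm of the radius. As it is bounded at the centre, it increases.\<close>

lemma line_integral_subharmonic:
  fixes w :: "complex \<Rightarrow> real"
  assumes J1: "has_jet 1 (\<lambda>z. w (exp z)) a1 a2" and J2: "has_jet \<i> (\<lambda>z. w (exp z)) b1 b2"
    and lap: "\<And>z. z \<in> left_half \<Longrightarrow> 0 \<le> a2 z + b2 z" and w0: "isCont w 0"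
  shows line_integral_subharmonic_mono:
      "\<And>t t'. t \<le> t' \<Longrightarrow> t' < 0 \<Longrightarrow>
        line_integral (\<lambda>z. w (exp z)) t \<le> line_integral (\<lambda>z. w (exp z)) t'"
    and line_integral_subharmonic_ge: "\<And>t. t < 0 \<Longrightarrow> 2 * pi * w 0 \<le> line_integral (\<lambda>z. w (exp z)) t"
proof -
  let ?M = "line_integral (\<lambda>z. w (exp z))"
  have D1: "(?M has_real_derivative line_integral a1 t) (at t)"
   and D2: "(line_integral a1 has_real_derivative line_integral a2 t) (at t)" if "t < 0" for t
    using J1 that unfolding has_jet_def
    by (auto intro!: line_integral_has_derivative)
  have cont: "continuous_on left_half a2" "continuous_on left_half b2"
    "continuous_on left_half (\<lambda>z. w (exp z))"
    using J1 J2 unfolding has_jet_def by auto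
  have L2: "0 \<le> line_integral a2 t" if "t < 0" for t
  proof -
    have "line_integral a2 t = line_integral a2 t + line_integral b2 t"
      using line_integral_second_imaginary_derivative[OF J2 that] by simp
    also have "\<dots> = integral {0..2 * pi} (\<lambda>\<theta>. a2 (Complex t \<theta>) + b2 (Complex t \<theta>))"
      unfolding line_integral_def
      by (subst integral_add)
        (auto intro!: integrable_continuous_interval continuous_on_line cont that)
    also have "\<dots> \<ge> 0"
      by (rule integral_nonneg)
        (auto intro!: integrable_continuous_interval continuous_on_line cont that lap
          continuous_intros)
    finally show ?thesis .
  qed
  have lim: "(?M \<longlongrightarrow> 2 * pi * w 0) at_bot"
    by (rule line_integral_tendsto[OF w0 cont(3)])
  have M1: "0 \<le> line_integral a1 t" if t: "t < 0" for t
  proof (rule ccontr)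
    assume neg: "\<not> ?thesis"
    define m where "m = - line_integral a1 t"
    have m: "0 < m" using neg m_def by simp
    \<comment> \<open>The slope increases, so to the left of \<open>t\<close> the graph stays above
      its tangent of slope \<open>- m\<close>. It would exceed every bound there, against
      \<open>lim\<close>.\<close>
    have up: "?M t + m * (t - x) \<le> ?M x" if xt: "x < t" for x
    proof -
      obtain y where y: "x < y" "y < t" "?M t - ?M x = (t - x) * line_integral a1 y"
        using MVT2[OF xt, of ?M "line_integral a1"] D1 t by (meson le_less_trans)
      have "line_integral a1 y \<le> line_integral a1 t"
      proof (rule DERIV_nonneg_imp_nondecreasing[of y t])
        fix x assume "y \<le> x" "x \<le> t"
        then show "\<exists>k. (line_integral a1 has_real_derivative k) (at x) \<and> 0 \<le> k"
          using D2[of x] L2[of x] t by auto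
      qed (use y in simp)
      then have "(t - x) * line_integral a1 y \<le> (t - x) * (- m)"
        using xt by (intro mult_left_mono) (auto simp: m_def)
      with y(3) show ?thesis by (simp add: algebra_simps)
    qed
    have "eventually (\<lambda>x. ?M x < 2 * pi * w 0 + 1) at_bot"
      by (rule order_tendstoD[OF lim]) simp
    moreover have "eventually (\<lambda>x. x < min t (t - (2 * pi * w 0 + 1 - ?M t) / m)) at_bot"
      by (rule eventually_gt_at_bot)
    ultimately have "eventually (\<lambda>x. False) (at_bot :: real filter)"
    proof eventually_elim
      case (elim x)
      then have "(2 * pi * w 0 + 1 - ?M t) / m < t - x" by simp
      then have "2 * pi * w 0 + 1 - ?M t < m * (t - x)"
        using m by (simp add: field_simps)
      with up[of x] elim show ?case by simp
    qed
    then show False by simp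
  qed
  show mono: "?M t \<le> ?M t'" if "t \<le> t'" "t' < 0" for t t'
  proof (rule DERIV_nonneg_imp_nondecreasing[OF that(1)])
    fix x assume "x \<le> t'"
    then show "\<exists>k. (?M has_real_derivative k) (at x) \<and> 0 \<le> k"
      using D1[of x] M1[of x] that by auto
  qed
  show "2 * pi * w 0 \<le> ?M t" if "t < 0" for t
  proof (rule tendsto_upperbound[OF lim])
    show "eventually (\<lambda>x. ?M x \<le> ?M t) at_bot"
      using eventually_le_at_bot[of t] by eventually_elim (use mono that in auto)
  qed simp
qed

section \<open>Real inequalities behind the subharmonic combinations\<close>

text \<open>Read \<open>x\<close>, \<open>n\<close> as \<open>X\<close>, \<open>N\<close>, further
  \<open>a\<close>, \<open>b\<close> as their squared gradients and \<open>E\<close>,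
  \<open>E + G\<close> as their Laplacians, up to a factor 4. As \<open>s - 1 \<le> 0\<close>, the
  bound \<open>a \<le> x * E\<close> makes the first bracket at least \<open>s^2 x^(s-1) E\<close>.
  The second is at most \<open>2 s x^(s-1) E\<close>, because powers with exponent
  \<open>s - 1\<close> decrease. The quotient is \<open>2 / s\<close>.\<close>

lemma laplacian_bound_concave:
  fixes s x n a b E G :: real
  assumes s: "0 < s" "s \<le> 1" and x: "0 < x" "x \<le> n"
    and "a \<le> x * E" "0 \<le> b" "0 \<le> G" "G \<le> E"
  shows "0 \<le> 2 / s * (s * (s - 1) * x powr (s - 2) * a + s * x powr (s - 1) * E)
    - (s * (s - 1) * n powr (s - 2) * b + s * n powr (s - 1) * (E + G))"
proof -
  have E: "0 \<le> E" using assms by linarith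
  have "x powr (s - 2) * a \<le> x powr (s - 2) * (x * E)"
    using assms by (intro mult_left_mono) auto
  also have "\<dots> = x powr (s - 1) * E"
    using x powr_add[of x "s - 2" 1] by (simp add: algebra_simps)
  moreover have ss: "s * (s - 1) \<le> 0" using s by (simp add: mult_nonneg_nonpos)
  ultimately have "s * (s - 1) * (x powr (s - 1) * E) \<le> s * (s - 1) * (x powr (s - 2) * a)"
    by (intro mult_left_mono_neg) auto
  then have "s * (s - 1) * (x powr (s - 1) * E) + s * x powr (s - 1) * E
      \<le> s * (s - 1) * x powr (s - 2) * a + s * x powr (s - 1) * E"
    by (simp add: mult.assoc)
  then have "2 / s * (s * (s - 1) * (x powr (s - 1) * E) + s * x powr (s - 1) * E)
      \<le> 2 / s * (s * (s - 1) * x powr (s - 2) * a + s * x powr (s - 1) * E)"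
    using s by (intro mult_left_mono) auto
  moreover have "2 / s * (s * (s - 1) * (x powr (s - 1) * E) + s * x powr (s - 1) * E)
      = 2 * s * (x powr (s - 1) * E)"
    using s by (simp add: field_simps)
  moreover have "s * (s - 1) * n powr (s - 2) * b \<le> 0"
    using mult_nonpos_nonneg[OF mult_nonpos_nonneg[OF ss powr_ge_zero] assms(6)] .
  moreover have "s * n powr (s - 1) * (E + G) \<le> s * x powr (s - 1) * (2 * E)"
    using assms E by (intro mult_mono mult_left_mono powr_mono2') auto
  ultimately show ?thesis by argo
qed

text \<open>The term \<open>E * n powr (s - 1)\<close> from the product \<open>X N^(s-1)\<close>
  pays for the Laplacian of \<open>N^s\<close>. What may be negative is the inner product
  \<open>q\<close> of the two gradients. It is absorbed by that same term where \<open>x\<close> is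
  small against \<open>n\<close>, and by the Laplacian of \<open>X^s\<close> elsewhere.\<close>

lemma laplacian_bound_convex:
  fixes s x n a b E G q :: real
  assumes s: "1 \<le> s" and x: "0 < x" "x \<le> n"
    and a: "0 \<le> a" "a \<le> x * E" and b: "0 \<le> b" "b \<le> n * (E + G)" and G: "0 \<le> G" "G \<le> E"
    and q: "q\<^sup>2 \<le> a * b"
  shows "0 \<le> 16 * s\<^sup>2 * (64 * s\<^sup>2) powr (s - 1)
        * (s * (s - 1) * x powr (s - 2) * a + s * x powr (s - 1) * E)
      + 4 * s\<^sup>2 * (E * n powr (s - 1) + 2 * ((s - 1) * n powr (s - 2) * q)
          + x * ((s - 1) * (s - 2) * n powr (s - 3) * b + (s - 1) * n powr (s - 2) * (E + G)))
      - (s * (s - 1) * n powr (s - 2) * b + s * n powr (s - 1) * (E + G))"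
proof -
  have E: "0 \<le> E" and n: "0 < n" using assms by linarith+
  have n1: "n powr (s - 1) = n powr (s - 2) * n"
    using n powr_add[of n "s - 2" 1] by simp
  have n2: "n powr (s - 2) = n powr (s - 3) * n"
    using n powr_add[of n "s - 3" 1] by simp
  \<comment> \<open>The factor \<open>4 * s\<^sup>2\<close> in the claim provides twice this bound;
    the other half is kept for the cross term.\<close>
  have t1: "s * (s - 1) * n powr (s - 2) * b + s * n powr (s - 1) * (E + G)
      \<le> 2 * s\<^sup>2 * n powr (s - 1) * E"
  proof -
    have "s * (s - 1) * n powr (s - 2) * b \<le> s * (s - 1) * n powr (s - 2) * (n * (E + G))"
      using s b by (intro mult_left_mono) auto
    then have "s * (s - 1) * n powr (s - 2) * b + s * n powr (s - 1) * (E + G)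
        \<le> s\<^sup>2 * n powr (s - 1) * (E + G)"
      by (simp add: n1 power2_eq_square algebra_simps)
    also have "\<dots> \<le> s\<^sup>2 * n powr (s - 1) * (2 * E)"
      using G by (intro mult_left_mono) auto
    finally show ?thesis by simp
  qed
  \<comment> \<open>For \<open>s < 2\<close> the first summand is negative. Taking one copy of
    \<open>b\<close> out of \<open>n * (E + G)\<close> turns its factor \<open>s - 2\<close> into
    \<open>s - 1\<close>.\<close>
  have t2: "0 \<le> (s - 1) * (s - 2) * n powr (s - 3) * b + (s - 1) * n powr (s - 2) * (E + G)"
  proof -
    have "0 \<le> (s - 1) * n powr (s - 3) * ((s - 1) * b + (n * (E + G) - b))"
      using s b by (intro mult_nonneg_nonneg add_nonneg_nonneg) auto
    then show ?thesis by (simp add: n2 algebra_simps)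
  qed
  \<comment> \<open>The geometric mean appears since \<open>q\<close> is bounded by the root of
    \<open>a * b\<close>, where \<open>a \<le> x * E\<close> and
    \<open>b \<le> n * (2 * E)\<close>.\<close>
  define r where "r = sqrt (x * n)"
  have r: "0 \<le> r" "r\<^sup>2 = x * n" using x n by (auto simp: r_def)
  have "q\<^sup>2 \<le> (2 * E * r)\<^sup>2"
  proof -
    have "q\<^sup>2 \<le> (x * E) * (n * (E + G))"
      using q mult_mono[OF a(2) b(2)] a b x E by simp
    also have "\<dots> \<le> (x * E) * (n * (4 * E))"
      using x n E G by (intro mult_left_mono) auto
    finally show ?thesis by (simp add: power_mult_distrib r) (simp add: power2_eq_square algebra_simps)
  qed
  then have q': "- (2 * E * r) \<le> q"
    using E r by (simp flip: abs_le_square_iff)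
  have t3: "- (4 * (s - 1) * n powr (s - 2) * E * r) \<le> 2 * ((s - 1) * n powr (s - 2) * q)"
  proof -
    have "0 \<le> 2 * (s - 1) * n powr (s - 2)" using s by simp
    from mult_left_mono[OF q' this] show ?thesis by argo
  qed
  let ?A = "(64 * s\<^sup>2) powr (s - 1)"
  \<comment> \<open>Below the threshold \<open>r\<close> is at most \<open>n / (8 * s)\<close>, so
    the left side is at most half of \<open>n powr (s - 1)\<close>. Above it \<open>n\<close> is
    less than \<open>64 * s\<^sup>2 * x\<close>, whose power \<open>s - 1\<close> is the source of
    \<open>?A\<close>.\<close>
  have key: "4 * (s - 1) * n powr (s - 2) * r \<le> n powr (s - 1) / 2 + 4 * s * ?A * x powr (s - 1)"
  proof (cases "64 * s\<^sup>2 * x \<le> n")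
    case True
    have "(8 * s * r)\<^sup>2 = 64 * s\<^sup>2 * x * n"
      by (simp add: power_mult_distrib r algebra_simps)
    also have "\<dots> \<le> n\<^sup>2"
      using mult_right_mono[OF True, of n] n by (simp add: power2_eq_square)
    finally have "8 * s * r \<le> n" using n by (simp add: power2_le_iff_abs_le)
    moreover have "8 * (s - 1) * r \<le> 8 * s * r" using r by (simp add: algebra_simps)
    ultimately have "n powr (s - 2) * (8 * (s - 1) * r) \<le> n powr (s - 2) * n"
      by (intro mult_left_mono) auto
    then have "4 * (s - 1) * n powr (s - 2) * r \<le> n powr (s - 1) / 2"
      by (simp add: n1 algebra_simps)
    moreover have "0 \<le> 4 * s * ?A * x powr (s - 1)" using s by simp
    ultimately show ?thesis by linarith
  next
    case False
    have "r\<^sup>2 \<le> n\<^sup>2" using r x n by (simp add: power2_eq_square mult_right_mono)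
    then have "r \<le> n" using n by (simp add: power2_le_iff_abs_le)
    then have "4 * (s - 1) * n powr (s - 2) * r \<le> 4 * s * n powr (s - 2) * n"
      using s r by (intro mult_mono) auto
    also have "\<dots> = 4 * s * n powr (s - 1)" by (simp add: n1)
    also have "\<dots> \<le> 4 * s * (64 * s\<^sup>2 * x) powr (s - 1)"
      using False s n by (intro mult_left_mono powr_mono2) auto
    also have "\<dots> = 4 * s * ?A * x powr (s - 1)"
      using x by (simp add: powr_mult)
    finally show ?thesis by (simp add: add_increasing)
  qed
  have t4: "16 * s\<^sup>2 * ?A * (s * x powr (s - 1) * E)
      \<le> 16 * s\<^sup>2 * ?A * (s * (s - 1) * x powr (s - 2) * a + s * x powr (s - 1) * E)"
    using s a by (intro mult_left_mono) auto
  have "4 * s\<^sup>2 * (E * n powr (s - 1) - 4 * (s - 1) * n powr (s - 2) * E * r)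
      \<le> 4 * s\<^sup>2 * (E * n powr (s - 1) + 2 * ((s - 1) * n powr (s - 2) * q)
          + x * ((s - 1) * (s - 2) * n powr (s - 3) * b + (s - 1) * n powr (s - 2) * (E + G)))"
    using t3 mult_nonneg_nonneg[OF less_imp_le[OF x(1)] t2] by (intro mult_left_mono) auto
  moreover have "0 \<le> 4 * s\<^sup>2 * E * (n powr (s - 1) / 2 + 4 * s * ?A * x powr (s - 1)
      - 4 * (s - 1) * n powr (s - 2) * r)"
    using key E by (intro mult_nonneg_nonneg) auto
  ultimately show ?thesis
    using t1 t4 by (simp add: algebra_simps)
qed

section \<open>Subharmonicity in logarithmic coordinates\<close>

definition log_pull :: "(complex \<Rightarrow> complex) \<Rightarrow> complex \<Rightarrow> complex" where
  "log_pull f z = f (exp z)"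

lemma exp_left_half: "z \<in> left_half \<Longrightarrow> exp z \<in> unit_disc"
  by simp

lemma log_pull_holomorphic:
  assumes "f holomorphic_on unit_disc"
  shows "log_pull f holomorphic_on left_half"
  unfolding log_pull_def[abs_def]
  by (rule holomorphic_on_compose_gen[OF _ assms, unfolded o_def]) (auto intro!: holomorphic_intros)

lemma deriv_log_pull:
  assumes "f holomorphic_on unit_disc" "z \<in> left_half"
  shows "deriv (log_pull f) z = deriv f (exp z) * exp z"
proof -
  have "(f has_field_derivative deriv f (exp z)) (at (exp z))"
    using exp_left_half[OF assms(2)] by (intro holomorphic_derivI[OF assms(1)]) auto
  then have "(log_pull f has_field_derivative deriv f (exp z) * exp z) (at z)"
    unfolding log_pull_def[abs_def] by (rule DERIV_chain2) (rule DERIV_exp)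
  then show ?thesis by (rule DERIV_imp_deriv)
qed

text \<open>The summands \<open>0\<close>, the factors \<open>1\<close> and \<open>\<i>\<close>
  repeat literally what the jet of \<open>e + |f|^2\<close> yields in the two directions, so that
  the equation can be used for rewriting.\<close>

lemma gradient_square_sum:
  "(0 + 2 * Re (c * (d * 1)))\<^sup>2 + (0 + 2 * Re (c * (d * \<i>)))\<^sup>2 = 4 * (norm (c * d))\<^sup>2"
  unfolding cmod_power2 by (simp add: power2_eq_square algebra_simps)

lemma laplacian_norm_square_sum:
  "(0 + (2 * (norm (c * 1))\<^sup>2 + 2 * Re (a * (b * 1 * 1))))
    + (0 + (2 * (norm (c * \<i>))\<^sup>2 + 2 * Re (a * (b * \<i> * \<i>)))) = 4 * (norm c)\<^sup>2"
  by (simp add: norm_mult algebra_simps)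

lemma laplacian_powr_sum:
  "s * t * X * (a1::real) + s * Y * b1 + (s * t * X * a2 + s * Y * b2)
    = s * t * X * (a1 + a2) + s * Y * (b1 + b2)"
  by (simp add: algebra_simps)

text \<open>In logarithmic coordinates the Laplacian of \<open>u\<close> is
  \<open>4 s (e + |f|^2)^(s-2) |f'|^2 (s |f|^2 + e)\<close>, which is nonnegative for small
  \<open>s\<close> too.\<close>

lemma powr_subharmonic_mono:
  fixes f :: "complex \<Rightarrow> complex"
  assumes f: "f holomorphic_on unit_disc" and "0 < e" "0 < s"
  defines "u \<equiv> \<lambda>z. (e + (norm (f z))\<^sup>2) powr s"
  shows "\<And>t t'. t \<le> t' \<Longrightarrow> t' < 0 \<Longrightarrow>
      line_integral (\<lambda>z. u (exp z)) t \<le> line_integral (\<lambda>z. u (exp z)) t'"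
    and "\<And>t. t < 0 \<Longrightarrow> 2 * pi * u 0 \<le> line_integral (\<lambda>z. u (exp z)) t"
proof -
  let ?f = "log_pull f"
  define x where "x = (\<lambda>z. e + (norm (?f z))\<^sup>2)"
  have xpos: "0 < x z" for z using assms(2) by (simp add: x_def add_pos_nonneg)
  have Jx: "has_jet d x (\<lambda>z. 0 + 2 * Re (cnj (?f z) * (deriv ?f z * d)))
    (\<lambda>z. 0 + (2 * (norm (deriv ?f z * d))\<^sup>2 + 2 * Re (cnj (?f z) * (deriv (deriv ?f) z * d * d))))" for d
    unfolding x_def
    by (intro has_jet_add has_jet_const has_jet_norm_square log_pull_holomorphic f)
  have u: "(\<lambda>z. u (exp z)) = (\<lambda>z. x z powr s)"
    by (simp add: u_def x_def log_pull_def)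
  have "isCont f 0"
    using holomorphic_on_imp_continuous_on[OF f] by (simp add: continuous_on_eq_continuous_at)
  then have cont: "isCont u 0" unfolding u_def
    using assms(2,3) by (intro continuous_intros) (auto simp: add_nonneg_eq_0_iff)
  have lap: "0 \<le> s * (s - 1) * x z powr (s - 2) * (0 + 2 * Re (cnj (?f z) * (deriv ?f z * 1)))\<^sup>2 +
      s * x z powr (s - 1) * (0 + (2 * (norm (deriv ?f z * 1))\<^sup>2 + 2 * Re (cnj (?f z) * (deriv (deriv ?f) z * 1 * 1)))) +
     (s * (s - 1) * x z powr (s - 2) * (0 + 2 * Re (cnj (?f z) * (deriv ?f z * \<i>)))\<^sup>2 +
      s * x z powr (s - 1) * (0 + (2 * (norm (deriv ?f z * \<i>))\<^sup>2 + 2 * Re (cnj (?f z) * (deriv (deriv ?f) z * \<i> * \<i>)))))"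
    (is "0 \<le> ?L") for z
  proof -
    let ?P = "cnj (?f z) * deriv ?f z" and ?E = "(norm (deriv ?f z))\<^sup>2"
    have "?L = 4 * (s * (s - 1) * x z powr (s - 2) * (norm ?P)\<^sup>2 + s * x z powr (s - 1) * ?E)"
      unfolding laplacian_powr_sum gradient_square_sum laplacian_norm_square_sum
      by (simp add: algebra_simps)
    also have "\<dots> = 4 * s * x z powr (s - 2) * ?E * (s * (norm (?f z))\<^sup>2 + e)"
    proof -
      have "(norm ?P)\<^sup>2 = (norm (?f z))\<^sup>2 * ?E"
        by (simp add: norm_mult power_mult_distrib)
      moreover have "x z powr (s - 1) = x z powr (s - 2) * x z"
        using xpos[of z] powr_add[of "x z" "s - 2" 1] by simp
      ultimately show ?thesis by (simp only:) (simp add: x_def algebra_simps)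
    qed
    also have "\<dots> \<ge> 0" using assms(2,3) by simp
    finally show ?thesis .
  qed
  note M = line_integral_subharmonic[of u, unfolded u, OF has_jet_powr[OF Jx[of 1] xpos, of s] has_jet_powr[OF Jx[of \<i>] xpos, of s] lap cont]
  show "line_integral (\<lambda>z. u (exp z)) t \<le> line_integral (\<lambda>z. u (exp z)) t'"
    if "t \<le> t'" "t' < 0" for t t'
    using M(1)[OF that] by (simp add: u)
  show "2 * pi * u 0 \<le> line_integral (\<lambda>z. u (exp z)) t" if "t < 0" for t
    using M(2)[OF that] by (simp add: u)
qed


section \<open>Differentially subordinate functions\<close>

lemma norm_add_square_le:
  fixes a b c d :: complex
  assumes "0 \<le> e"
  shows "(norm (a * c + b * d))\<^sup>2 \<le> (e + (norm a)\<^sup>2 + (norm b)\<^sup>2) * ((norm c)\<^sup>2 + (norm d)\<^sup>2)"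
proof -
  have "(norm (a * c + b * d))\<^sup>2 \<le> (norm a * norm c + norm b * norm d)\<^sup>2"
    by (intro power_mono order.trans[OF norm_triangle_ineq]) (auto simp: norm_mult)
  also have "\<dots> \<le> ((norm a)\<^sup>2 + (norm b)\<^sup>2) * ((norm c)\<^sup>2 + (norm d)\<^sup>2)"
    using zero_le_power2[of "norm a * norm d - norm b * norm c"]
    by (simp add: power2_eq_square algebra_simps)
  also have "\<dots> \<le> (e + (norm a)\<^sup>2 + (norm b)\<^sup>2) * ((norm c)\<^sup>2 + (norm d)\<^sup>2)"
    using assms by (intro mult_right_mono) auto
  finally show ?thesis .
qed

lemma line_integral_mono:
  assumes "continuous_on left_half u" "continuous_on left_half v" "t < 0"
    "\<And>z. z \<in> left_half \<Longrightarrow> u z \<le> v z"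
  shows "line_integral u t \<le> line_integral v t"
  unfolding line_integral_def
  by (rule integral_le)
    (use assms in \<open>auto intro!: integrable_continuous_interval continuous_on_line\<close>)

lemma line_integral_add:
  assumes "continuous_on left_half u" "continuous_on left_half v" "t < 0"
  shows "line_integral (\<lambda>z. u z + v z) t = line_integral u t + line_integral v t"
  unfolding line_integral_def
  by (rule integral_add)
    (use assms in \<open>auto intro!: integrable_continuous_interval continuous_on_line\<close>)

lemma line_integral_cmult: "line_integral (\<lambda>z. c * u z) t = c * line_integral u t"
  by (simp add: line_integral_def)

text \<open>Below, \<open>X1 d\<close>, \<open>X2 d\<close>, \<open>Y1 d\<close>, \<open>Y2 d\<close> are first and second derivatives in the direction
  \<open>d\<close> of \<open>X\<close> and \<open>|F|\<^sup>2\<close> in logarithmic coordinates; the summands 0 come from the constant \<open>e\<close>,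
  which keeps the bases of all powers positive.\<close>

locale differentially_subordinate =
  fixes f F :: "complex \<Rightarrow> complex" and e :: real
  assumes f: "f holomorphic_on unit_disc" and F: "F holomorphic_on unit_disc"
    and sub: "\<And>z. z \<in> unit_disc \<Longrightarrow> norm (deriv F z) \<le> norm (deriv f z)"
    and F0: "F 0 = 0" and e: "0 < e"
begin

definition X :: "complex \<Rightarrow> real" where "X z = e + (norm (f z))\<^sup>2"
definition N :: "complex \<Rightarrow> real" where "N z = e + (norm (f z))\<^sup>2 + (norm (F z))\<^sup>2"

lemma X_pos: "0 < X z" and X_le_N: "X z \<le> N z" and N_pos: "0 < N z"
  using e by (auto simp: X_def N_def add_pos_nonneg)

text \<open>This is where \<open>F 0 = 0\<close> enters: at the centre both combinations below
  collapse to a nonnegative multiple of \<open>X 0 powr s\<close>, and subharmonicity carries that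
  sign to the circle means.\<close>

lemma N_0: "N 0 = X 0"
  by (simp add: N_def X_def F0)

lemma continuous_X_N:
  shows "continuous_on unit_disc X" "continuous_on unit_disc N" "isCont X 0" "isCont N 0"
    "continuous_on left_half (\<lambda>z. X (exp z))" "continuous_on left_half (\<lambda>z. N (exp z))"
proof -
  note c = holomorphic_on_imp_continuous_on[OF f] holomorphic_on_imp_continuous_on[OF F]
  show X: "continuous_on unit_disc X" and N: "continuous_on unit_disc N"
    unfolding X_def[abs_def] N_def[abs_def] by (intro continuous_intros c)+
  then show "isCont X 0" "isCont N 0"
    by (auto simp: continuous_on_eq_continuous_at)
  show "continuous_on left_half (\<lambda>z. X (exp z))" "continuous_on left_half (\<lambda>z. N (exp z))"
    by (rule continuous_on_compose2[OF X] continuous_on_compose2[OF N];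
        auto intro!: continuous_intros)+
qed

abbreviation "P z \<equiv> cnj (log_pull f z)"
abbreviation "Q z \<equiv> cnj (log_pull F z)"

abbreviation "X1 d z \<equiv> 0 + 2 * Re (P z * (deriv (log_pull f) z * d))"
abbreviation "X2 d z \<equiv> 0 + (2 * (norm (deriv (log_pull f) z * d))\<^sup>2
  + 2 * Re (P z * (deriv (deriv (log_pull f)) z * d * d)))"
abbreviation "Y1 d z \<equiv> 2 * Re (Q z * (deriv (log_pull F) z * d))"
abbreviation "Y2 d z \<equiv> 2 * (norm (deriv (log_pull F) z * d))\<^sup>2
  + 2 * Re (Q z * (deriv (deriv (log_pull F)) z * d * d))"

lemma jet_X: "has_jet d (\<lambda>z. X (exp z)) (X1 d) (X2 d)"
  unfolding X_def using has_jet_add[OF has_jet_const[of d e] has_jet_norm_square[OF log_pull_holomorphic[OF f], of d]]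
  by (simp add: log_pull_def)

lemma jet_N: "has_jet d (\<lambda>z. N (exp z)) (\<lambda>z. X1 d z + Y1 d z) (\<lambda>z. X2 d z + Y2 d z)"
  using has_jet_add[OF jet_X has_jet_norm_square[OF log_pull_holomorphic[OF F]]]
  by (simp add: N_def X_def log_pull_def)

text \<open>Up to the factor 4, \<open>E\<close> and \<open>E + G\<close> are the Laplacians of
  \<open>X\<close> and \<open>N\<close> in logarithmic coordinates, \<open>A\<close> and
  \<open>B\<close> are the squared lengths of their gradients, and \<open>R\<close> is the inner
  product of these gradients.\<close>

abbreviation "E z \<equiv> (norm (deriv (log_pull f) z))\<^sup>2"
abbreviation "G z \<equiv> (norm (deriv (log_pull F) z))\<^sup>2"
abbreviation "A z \<equiv> (norm (P z * deriv (log_pull f) z))\<^sup>2"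
abbreviation "B z \<equiv> (norm (P z * deriv (log_pull f) z + Q z * deriv (log_pull F) z))\<^sup>2"
abbreviation "R z \<equiv> Re (P z * deriv (log_pull f) z
  * cnj (P z * deriv (log_pull f) z + Q z * deriv (log_pull F) z))"

text \<open>For \<open>d = 1\<close> and \<open>d = \<i>\<close> the number
  \<open>Re (c * d)\<close> is the real part and minus the imaginary part of \<open>c\<close>.
  Squares therefore add up to a squared modulus, and products to the real part of a product with a
  conjugate.\<close>

lemma sums:
  "(X1 1 z)\<^sup>2 + (X1 \<i> z)\<^sup>2 = 4 * A z" "X2 1 z + X2 \<i> z = 4 * E z"
  "(X1 1 z + Y1 1 z)\<^sup>2 + (X1 \<i> z + Y1 \<i> z)\<^sup>2 = 4 * B z"
  "(X2 1 z + Y2 1 z) + (X2 \<i> z + Y2 \<i> z) = 4 * (E z + G z)"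
  "X1 1 z * (X1 1 z + Y1 1 z) + X1 \<i> z * (X1 \<i> z + Y1 \<i> z) = 4 * R z"
proof -
  show "(X1 1 z)\<^sup>2 + (X1 \<i> z)\<^sup>2 = 4 * A z" "X2 1 z + X2 \<i> z = 4 * E z"
    by (rule gradient_square_sum laplacian_norm_square_sum)+
  show "(X2 1 z + Y2 1 z) + (X2 \<i> z + Y2 \<i> z) = 4 * (E z + G z)"
    by (simp add: norm_mult algebra_simps)
  show "(X1 1 z + Y1 1 z)\<^sup>2 + (X1 \<i> z + Y1 \<i> z)\<^sup>2 = 4 * B z"
    unfolding cmod_power2 by (simp add: power2_eq_square algebra_simps)
  show "X1 1 z * (X1 1 z + Y1 1 z) + X1 \<i> z * (X1 \<i> z + Y1 \<i> z) = 4 * R z"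
    by (simp add: algebra_simps)
qed

text \<open>These are the hypotheses of the two real inequalities above. The bound on
  \<open>B\<close> is the Cauchy-Schwarz inequality. Subordination survives the change of
  coordinates because both derivatives gain the same factor \<open>exp z\<close>.\<close>

lemma bounds:
  assumes "z \<in> left_half"
  shows "A z \<le> X (exp z) * E z" "B z \<le> N (exp z) * (E z + G z)" "G z \<le> E z"
    "(R z)\<^sup>2 \<le> A z * B z"
proof -
  show "A z \<le> X (exp z) * E z"
    unfolding norm_mult power_mult_distrib
    using e by (intro mult_right_mono) (simp_all add: X_def log_pull_def)
  show "B z \<le> N (exp z) * (E z + G z)"
    using norm_add_square_le[of e "P z" "deriv (log_pull f) z" "Q z" "deriv (log_pull F) z"] e
    by (simp add: N_def log_pull_def)
  show "G z \<le> E z"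
    unfolding deriv_log_pull[OF f assms] deriv_log_pull[OF F assms] norm_mult
    by (intro power_mono mult_right_mono sub exp_left_half assms) auto
  have "\<bar>R z\<bar> \<le> norm (P z * deriv (log_pull f) z)
      * norm (P z * deriv (log_pull f) z + Q z * deriv (log_pull F) z)"
    using abs_Re_le_cmod[of "P z * deriv (log_pull f) z
      * cnj (P z * deriv (log_pull f) z + Q z * deriv (log_pull F) z)"]
    by (simp only: norm_mult complex_mod_cnj)
  from power_mono[OF this abs_ge_zero, of 2] show "(R z)\<^sup>2 \<le> A z * B z"
    by (simp only: power2_abs power_mult_distrib)
qed

lemma continuous_powr:
  "continuous_on left_half (\<lambda>z. X (exp z) powr s)" "continuous_on left_half (\<lambda>z. N (exp z) powr s)"
  "isCont (\<lambda>z. X z powr s) 0" "isCont (\<lambda>z. N z powr s) 0"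
  using continuous_X_N X_pos N_pos by (auto intro!: continuous_intros simp: less_imp_neq[symmetric])

text \<open>For \<open>s \<le> 1\<close> the function \<open>(2 / s) X\<^sup>s - N\<^sup>s\<close> is subharmonic. For \<open>s \<ge> 1\<close> the same holds for
  \<open>K X\<^sup>s + L X N\<^sup>s\<^sup>-\<^sup>1 - N\<^sup>s\<close>, a smooth variant of Burkholder's function for differentially
  subordinate martingales.\<close>

lemma comparison_concave:
  assumes s: "0 < s" "s \<le> 1" and t: "t < 0"
  shows "line_integral (\<lambda>z. N (exp z) powr s) t \<le> 2 / s * line_integral (\<lambda>z. X (exp z) powr s) t"
proof -
  define w where "w = (\<lambda>z. 2 / s * X z powr s + (-1) * N z powr s)"
  note J = has_jet_add[OF has_jet_cmult[OF has_jet_powr[OF jet_X X_pos]]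
      has_jet_cmult[OF has_jet_powr[OF jet_N N_pos]]]
  have "0 \<le> w 0"
    using s by (simp add: w_def N_0 mult_right_mono[of 1 "2 / s" "X 0 powr s", simplified])
  also have "2 * pi * w 0 \<le> line_integral (\<lambda>z. w (exp z)) t"
    unfolding w_def
  proof (rule line_integral_subharmonic_ge[OF J J _ _ t])
    fix z assume z: "z \<in> left_half"
    \<comment> \<open>Pairs the terms of the two directions, so that only squared gradients and
      Laplacians remain for \<open>sums\<close>; \<open>eq4\<close> then pulls out their common
      factor 4.\<close>
    have eq: "c * (p * a1 + q * b1) + (-1) * (p' * c1 + q' * d1)
        + (c * (p * a2 + q * b2) + (-1) * (p' * c2 + q' * d2))
      = c * (p * (a1 + a2) + q * (b1 + b2)) - (p' * (c1 + c2) + q' * (d1 + d2))"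
      for c p q a1 b1 p' q' c1 d1 a2 b2 c2 d2 :: real
      by (simp add: algebra_simps)
    have eq4: "c * (p * (4 * a) + q * (4 * b)) - (p' * (4 * c') + q' * (4 * d))
      = 4 * (c * (p * a + q * b) - (p' * c' + q' * d))" for c p q a b p' q' c' d :: real
      by (simp add: algebra_simps)
    show "0 \<le> 2 / s * (s * (s - 1) * X (exp z) powr (s - 2) * (X1 1 z)\<^sup>2 + s * X (exp z) powr (s - 1) * X2 1 z)
       + (-1) * (s * (s - 1) * N (exp z) powr (s - 2) * (X1 1 z + Y1 1 z)\<^sup>2
          + s * N (exp z) powr (s - 1) * (X2 1 z + Y2 1 z))
       + (2 / s * (s * (s - 1) * X (exp z) powr (s - 2) * (X1 \<i> z)\<^sup>2 + s * X (exp z) powr (s - 1) * X2 \<i> z)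
       + (-1) * (s * (s - 1) * N (exp z) powr (s - 2) * (X1 \<i> z + Y1 \<i> z)\<^sup>2
          + s * N (exp z) powr (s - 1) * (X2 \<i> z + Y2 \<i> z)))"
      unfolding eq sums eq4
      by (intro mult_nonneg_nonneg laplacian_bound_concave s X_pos X_le_N bounds z) auto
  next
    show "isCont (\<lambda>z. 2 / s * X z powr s + (-1) * N z powr s) 0"
      using continuous_X_N X_pos[of 0] N_pos[of 0] by (intro continuous_intros) auto
  qed
  also have "\<dots> = 2 / s * line_integral (\<lambda>z. X (exp z) powr s) t + (-1) * line_integral (\<lambda>z. N (exp z) powr s) t"
    unfolding w_def
    by (subst line_integral_add)
      (auto simp only: line_integral_cmult intro!: continuous_on_mult_left continuous_powr t)
  finally show ?thesis by simp
qed


lemma comparison_convex: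
  assumes s: "1 \<le> s" and t: "t < 0"
  shows "line_integral (\<lambda>z. N (exp z) powr s) t
    \<le> 2 * (16 * s\<^sup>2 * (64 * s\<^sup>2) powr (s - 1) + 4 * s\<^sup>2 * (8 * s\<^sup>2) powr (s - 1))
      * line_integral (\<lambda>z. X (exp z) powr s) t"
proof -
  define K L where "K = 16 * s\<^sup>2 * (64 * s\<^sup>2) powr (s - 1)" and "L = 4 * s\<^sup>2"
  have s2: "1 \<le> s\<^sup>2" using s by (simp add: one_le_power)
  have L: "1 \<le> L" using s2 by (simp add: L_def)
  have K: "0 \<le> K" by (simp add: K_def)
  define w where "w = (\<lambda>z. K * X z powr s + (L * (X z * N z powr (s - 1)) + (-1) * N z powr s))"
  have ex: "s - 1 - 1 = s - 2" "s - 1 - 2 = s - 3" by simp_all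
  note J = has_jet_add[OF has_jet_cmult[OF has_jet_powr[OF jet_X X_pos]]
      has_jet_add[OF has_jet_cmult[OF has_jet_mult[OF jet_X has_jet_powr[OF jet_N N_pos, of _ "s - 1", unfolded ex]]]
      has_jet_cmult[OF has_jet_powr[OF jet_N N_pos]]]]
  have "X 0 * X 0 powr (s - 1) = X 0 powr s"
    using X_pos[of 0] powr_add[of "X 0" 1 "s - 1"] by simp
  then have "w 0 = (K + L - 1) * X 0 powr s"
    by (simp add: w_def N_0 algebra_simps)
  then have "0 \<le> w 0"
    using K L by simp
  then have "0 \<le> 2 * pi * w 0" by simp
  also have "2 * pi * w 0 \<le> line_integral (\<lambda>z. w (exp z)) t"
    unfolding w_def
  proof (rule line_integral_subharmonic_ge[OF J J _ _ t])
    fix z assume z: "z \<in> left_half"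
    have eq: "c * (p * a1 + q * b1) + (l * (b1 * m + 2 * (a1' * (k * c1)) + x * (r * c1' + k * d1))
          + (-1) * (p' * c1' + q' * d1))
        + (c * (p * a2 + q * b2) + (l * (b2 * m + 2 * (a2' * (k * c2)) + x * (r * c2' + k * d2))
          + (-1) * (p' * c2' + q' * d2)))
      = c * (p * (a1 + a2) + q * (b1 + b2))
        + l * ((b1 + b2) * m + 2 * (k * (a1' * c1 + a2' * c2)) + x * (r * (c1' + c2') + k * (d1 + d2)))
        - (p' * (c1' + c2') + q' * (d1 + d2))"
      for c p q a1 b1 l m k c1 x r c1' d1 p' q' a2 b2 c2 c2' d2 a1' a2' :: real
      by (simp add: algebra_simps)
    have eq4: "c * (p * (4 * a) + q * (4 * b))
        + l * (4 * b * m + 2 * (k * (4 * g)) + x * (r * (4 * c') + k * (4 * d)))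
        - (p' * (4 * c') + q' * (4 * d))
      = 4 * (c * (p * a + q * b) + l * (b * m + 2 * (k * g) + x * (r * c' + k * d))
        - (p' * c' + q' * d))" for c p q a b l m k g x r c' d p' q' :: real
      by (simp add: algebra_simps)
    show "0 \<le> K * (s * (s - 1) * X (exp z) powr (s - 2) * (X1 1 z)\<^sup>2 + s * X (exp z) powr (s - 1) * X2 1 z)
       + (L * (X2 1 z * N (exp z) powr (s - 1)
            + 2 * (X1 1 z * ((s - 1) * N (exp z) powr (s - 2) * (X1 1 z + Y1 1 z)))
            + X (exp z) * ((s - 1) * (s - 2) * N (exp z) powr (s - 3) * (X1 1 z + Y1 1 z)\<^sup>2
               + (s - 1) * N (exp z) powr (s - 2) * (X2 1 z + Y2 1 z)))
         + (-1) * (s * (s - 1) * N (exp z) powr (s - 2) * (X1 1 z + Y1 1 z)\<^sup>2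
          + s * N (exp z) powr (s - 1) * (X2 1 z + Y2 1 z)))
       + (K * (s * (s - 1) * X (exp z) powr (s - 2) * (X1 \<i> z)\<^sup>2 + s * X (exp z) powr (s - 1) * X2 \<i> z)
       + (L * (X2 \<i> z * N (exp z) powr (s - 1)
            + 2 * (X1 \<i> z * ((s - 1) * N (exp z) powr (s - 2) * (X1 \<i> z + Y1 \<i> z)))
            + X (exp z) * ((s - 1) * (s - 2) * N (exp z) powr (s - 3) * (X1 \<i> z + Y1 \<i> z)\<^sup>2
               + (s - 1) * N (exp z) powr (s - 2) * (X2 \<i> z + Y2 \<i> z)))
         + (-1) * (s * (s - 1) * N (exp z) powr (s - 2) * (X1 \<i> z + Y1 \<i> z)\<^sup>2
          + s * N (exp z) powr (s - 1) * (X2 \<i> z + Y2 \<i> z))))"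
      unfolding eq sums eq4 unfolding K_def L_def
      by (intro mult_nonneg_nonneg laplacian_bound_convex s X_pos X_le_N bounds z) auto
  next
    show "isCont (\<lambda>z. K * X z powr s + (L * (X z * N z powr (s - 1)) + (-1) * N z powr s)) 0"
      using continuous_X_N(3) by (intro continuous_intros continuous_powr)
  qed
  finally have w: "0 \<le> line_integral (\<lambda>z. w (exp z)) t" .
  \<comment> \<open>Either the middle term of the sum is at most half of the last one, or it is absorbed by the first.\<close>
  have pt: "w (exp z) \<le> (K + L * (2 * L) powr (s - 1)) * X (exp z) powr s + (- (1 / 2)) * N (exp z) powr s" for z
  proof -
    define x n where "x = X (exp z)" and "n = N (exp z)"
    have x: "0 < x" "x \<le> n" using X_pos X_le_N by (auto simp: x_def n_def)
    have np: "n powr s = n * n powr (s - 1)" "x powr s = x * x powr (s - 1)"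
      using x powr_add[of n 1 "s - 1"] powr_add[of x 1 "s - 1"] by auto
    have "L * (x * n powr (s - 1)) \<le> L * (2 * L) powr (s - 1) * x powr s + 1 / 2 * n powr s"
    proof (cases "2 * L * x \<le> n")
      case True
      then have "2 * L * x * n powr (s - 1) \<le> n * n powr (s - 1)"
        by (intro mult_right_mono) auto
      moreover have "0 \<le> L * (2 * L) powr (s - 1) * x powr s"
        using L by simp
      ultimately show ?thesis by (simp add: np)
    next
      case False
      then have "L * (x * n powr (s - 1)) \<le> L * (x * (2 * L * x) powr (s - 1))"
        using L s x by (intro mult_left_mono powr_mono2) auto
      also have "\<dots> = L * (2 * L) powr (s - 1) * x powr s"
        using L x by (simp add: powr_mult np)
      finally show ?thesis by (simp add: add_increasing2)
    qed
    then show ?thesis by (simp add: w_def x_def n_def algebra_simps)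
  qed
  have "line_integral (\<lambda>z. w (exp z)) t
      \<le> line_integral (\<lambda>z. (K + L * (2 * L) powr (s - 1)) * X (exp z) powr s + (- (1 / 2)) * N (exp z) powr s) t"
    by (intro line_integral_mono pt t)
      (auto simp: w_def intro!: continuous_intros continuous_powr continuous_X_N)
  also have "\<dots> = (K + L * (2 * L) powr (s - 1)) * line_integral (\<lambda>z. X (exp z) powr s) t
      + (- (1 / 2)) * line_integral (\<lambda>z. N (exp z) powr s) t"
    by (subst line_integral_add)
      (auto simp only: line_integral_cmult intro!: continuous_on_mult_left continuous_powr t)
  finally have "line_integral (\<lambda>z. N (exp z) powr s) t
      \<le> 2 * (K + L * (2 * L) powr (s - 1)) * line_integral (\<lambda>z. X (exp z) powr s) t"
    using w by argo
  then show ?thesis by (simp add: K_def L_def)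
qed

end

section \<open>Integral means of analytic functions\<close>

lemma borel_measurable_disc_analytic:
  assumes "f \<in> disc_analytic"
  shows "f \<in> borel_measurable borel"
proof -
  have "continuous_on unit_disc f"
    using assms by (auto simp: disc_analytic_def intro: holomorphic_on_imp_continuous_on)
  then have "(\<lambda>z. indicator unit_disc z *\<^sub>R f z) \<in> borel_measurable borel"
    by (intro borel_measurable_continuous_on_indicator) auto
  also have "(\<lambda>z. indicator unit_disc z *\<^sub>R f z) = f"
    using assms by (auto simp: disc_analytic_def indicator_def fun_eq_iff)
  finally show ?thesis .
qed

lemma exp_log_polar: "0 < r \<Longrightarrow> exp (Complex (ln r) \<theta>) = of_real r * cis \<theta>"
  by (simp add: Complex_eq exp_add exp_of_real mult.commute[of \<i>] flip: cis_conv_exp)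
    (simp add: cis_conv_exp mult.commute)

lemma integral_mean_eq_line_integral:
  assumes f: "f \<in> disc_analytic" and p: "0 < p" and r: "0 < r" "r < 1"
  shows "integral_mean p f r = line_integral (\<lambda>z. norm (f (exp z)) powr p) (ln r) / (2 * pi)"
proof -
  note [measurable] = borel_measurable_disc_analytic[OF f]
  let ?h = "\<lambda>\<theta>. norm (f (of_real r * cis \<theta>)) powr p"
  have "continuous_on UNIV cis"
    unfolding cis_conv_exp by (intro continuous_intros)
  then have [measurable]: "cis \<in> borel_measurable borel"
    by (rule borel_measurable_continuous_onI)
  have "continuous_on unit_disc f"
    using f by (auto simp: disc_analytic_def intro: holomorphic_on_imp_continuous_on)
  moreover have "continuous_on {0..2 * pi} (\<lambda>\<theta>. of_real r * cis \<theta>)"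
    unfolding cis_conv_exp by (intro continuous_intros)
  ultimately have "continuous_on {0..2 * pi} (\<lambda>\<theta>. f (of_real r * cis \<theta>))"
    by (rule continuous_on_compose2) (use r in \<open>auto simp: norm_mult\<close>)
  then have cont: "continuous_on {0..2 * pi} ?h"
    using p by (intro continuous_on_powr' continuous_intros) auto
  have um: "uniform_measure lborel {0..2 * pi}
      = density lborel (\<lambda>x. ennreal (indicator {0..2 * pi} x / (2 * pi)))"
    unfolding uniform_measure_def
    by (intro density_cong) (auto simp: indicator_def divide_ennreal simp flip: ennreal_1)
  have "integral_mean p f r = (LINT \<theta>|uniform_measure lborel {0..2 * pi}. ?h \<theta>)"
    unfolding integral_mean_def circle_measure_def by (rule integral_distr) measurable
  also have "\<dots> = (LINT \<theta>|lborel. (indicator {0..2 * pi} \<theta> / (2 * pi)) *\<^sub>R ?h \<theta>)"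
    unfolding um by (rule integral_density) auto
  also have "\<dots> = (LINT \<theta>:{0..2 * pi}|lborel. ?h \<theta>) / (2 * pi)"
    unfolding set_lebesgue_integral_def by simp
  also have "(LINT \<theta>:{0..2 * pi}|lborel. ?h \<theta>) = integral {0..2 * pi} ?h"
    by (intro set_borel_integral_eq_integral borel_integrable_atLeastAtMost' cont)
  finally show ?thesis
    using r by (simp add: line_integral_def exp_log_polar)
qed

lemma square_powr: "0 \<le> (a::real) \<Longrightarrow> (a\<^sup>2) powr s = a powr (2 * s)"
  by (cases "a = 0") (auto simp: powr_powr simp flip: powr_numeral)

text \<open>For positive \<open>s\<close> the integrand is jointly continuous up to
  \<open>e = 0\<close>, even at zeros of \<open>f\<close>. The parameter set \<open>{0..}\<close>
  keeps the base of the power nonnegative.\<close>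

lemma line_integral_powr_tendsto:
  assumes f: "f holomorphic_on unit_disc" and s: "0 < s" and t: "t < 0"
  shows "((\<lambda>e. line_integral (\<lambda>z. (e + (norm (f (exp z)))\<^sup>2) powr s) t)
    \<longlongrightarrow> line_integral (\<lambda>z. norm (f (exp z)) powr (2 * s)) t) (at_right 0)"
proof -
  have c: "continuous_on unit_disc f"
    using f by (rule holomorphic_on_imp_continuous_on)
  have "continuous_on ({0..} \<times> cbox 0 (2 * pi))
      (\<lambda>(e, \<theta>). (e + (norm (f (exp (Complex t \<theta>))))\<^sup>2) powr s)"
    unfolding split_beta
    by (intro continuous_on_powr' continuous_intros continuous_on_compose2[OF c])
      (use t s in \<open>auto simp: Complex_eq intro!: continuous_intros\<close>)
  then have "continuous_on {0..} (\<lambda>e. line_integral (\<lambda>z. (e + (norm (f (exp z)))\<^sup>2) powr s) t)"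
    unfolding line_integral_def cbox_interval[symmetric] by (rule integral_continuous_on_param)
  then have "((\<lambda>e. line_integral (\<lambda>z. (e + (norm (f (exp z)))\<^sup>2) powr s) t)
    \<longlongrightarrow> line_integral (\<lambda>z. (0 + (norm (f (exp z)))\<^sup>2) powr s) t) (at 0 within {0..})"
    unfolding continuous_on_def by (rule bspec) simp
  then show ?thesis
    by (auto simp: square_powr intro: tendsto_within_subset)
qed

lemma integral_mean_mono:
  assumes f: "f \<in> disc_analytic" and p: "0 < p" and r: "0 < r" "r \<le> r'" "r' < 1"
  shows "integral_mean p f r \<le> integral_mean p f r'"
proof -
  have hol: "f holomorphic_on unit_disc" using f by (simp add: disc_analytic_def)
  have ev: "\<forall>\<^sub>F e in at_right 0.
      line_integral (\<lambda>z. (e + (norm (f (exp z)))\<^sup>2) powr (p / 2)) (ln r)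
      \<le> line_integral (\<lambda>z. (e + (norm (f (exp z)))\<^sup>2) powr (p / 2)) (ln r')"
    using eventually_at_right_less[of 0]
    by eventually_elim (use p r in \<open>intro powr_subharmonic_mono(1)[OF hol]; auto\<close>)
  have "line_integral (\<lambda>z. norm (f (exp z)) powr (2 * (p / 2))) (ln r)
      \<le> line_integral (\<lambda>z. norm (f (exp z)) powr (2 * (p / 2))) (ln r')"
    by (rule tendsto_le[OF _ line_integral_powr_tendsto[OF hol] line_integral_powr_tendsto[OF hol] ev])
      (use p r in auto)
  then show ?thesis
    using p r by (simp add: integral_mean_eq_line_integral[OF f p] divide_right_mono)
qed

text \<open>Serves to bound the constant \<open>h 0 / l\<close> in the resolvent by the means of
  \<open>h\<close>.\<close>

lemma integral_mean_ge_center: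
  assumes f: "f \<in> disc_analytic" and p: "0 < p" and r: "0 < r" "r < 1"
  shows "norm (f 0) powr p \<le> integral_mean p f r"
proof -
  have hol: "f holomorphic_on unit_disc" using f by (simp add: disc_analytic_def)
  have ev: "\<forall>\<^sub>F e in at_right 0. 2 * pi * norm (f 0) powr p
      \<le> line_integral (\<lambda>z. (e + (norm (f (exp z)))\<^sup>2) powr (p / 2)) (ln r)"
    using eventually_at_right_less[of 0]
  proof eventually_elim
    case (elim e)
    have "norm (f 0) powr p = ((norm (f 0))\<^sup>2) powr (p / 2)"
      by (simp add: square_powr)
    also have "\<dots> \<le> (e + (norm (f 0))\<^sup>2) powr (p / 2)"
      using elim p by (intro powr_mono2) auto
    finally have "2 * pi * norm (f 0) powr p \<le> 2 * pi * (e + (norm (f 0))\<^sup>2) powr (p / 2)"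
      by simp
    also have "\<dots> \<le> line_integral (\<lambda>z. (e + (norm (f (exp z)))\<^sup>2) powr (p / 2)) (ln r)"
      using elim p r by (intro powr_subharmonic_mono(2)[OF hol]) auto
    finally show ?case .
  qed
  have "2 * pi * norm (f 0) powr p \<le> line_integral (\<lambda>z. norm (f (exp z)) powr (2 * (p / 2))) (ln r)"
    by (rule tendsto_lowerbound[OF line_integral_powr_tendsto[OF hol] ev]) (use p r in auto)
  then show ?thesis
    using p r by (simp add: integral_mean_eq_line_integral[OF f p] field_simps)
qed

text \<open>\<open>K\<close> depends on \<open>p\<close> alone, so the estimate passes to the limit
  in \<open>r\<close> and to operator norms. The exponent is halved because \<open>X\<close> and
  \<open>N\<close> are built from squares. The left side is free of \<open>e\<close> as
  \<open>|F|^p\<close> is at most \<open>N^s\<close>, so only the right side needs the limit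
  \<open>e -> 0\<close>.\<close>

lemma integral_mean_subordinate:
  assumes p: "0 < p"
  obtains K where "0 \<le> K"
    "\<And>f F r. f \<in> disc_analytic \<Longrightarrow> F \<in> disc_analytic \<Longrightarrow> F 0 = 0 \<Longrightarrow>
      (\<And>z. z \<in> unit_disc \<Longrightarrow> norm (deriv F z) \<le> norm (deriv f z)) \<Longrightarrow> 0 < r \<Longrightarrow> r < 1 \<Longrightarrow>
      integral_mean p F r \<le> K * integral_mean p f r"
proof -
  define s where "s = p / 2"
  have s: "0 < s" using p by (simp add: s_def)
  define K where "K = (if s \<le> 1 then 2 / s else
    2 * (16 * s\<^sup>2 * (64 * s\<^sup>2) powr (s - 1) + 4 * s\<^sup>2 * (8 * s\<^sup>2) powr (s - 1)))"
  have K: "0 \<le> K" using s by (simp add: K_def)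
  moreover have "integral_mean p F r \<le> K * integral_mean p f r"
    if f: "f \<in> disc_analytic" and F: "F \<in> disc_analytic" "F 0 = 0"
      "\<And>z. z \<in> unit_disc \<Longrightarrow> norm (deriv F z) \<le> norm (deriv f z)" and r: "0 < r" "r < 1" for f F r
  proof -
    have hol: "f holomorphic_on unit_disc" "F holomorphic_on unit_disc"
      using f F by (auto simp: disc_analytic_def)
    have t: "ln r < 0" using r by simp
    have ev: "\<forall>\<^sub>F e in at_right 0. line_integral (\<lambda>z. norm (F (exp z)) powr p) (ln r)
        \<le> K * line_integral (\<lambda>z. (e + (norm (f (exp z)))\<^sup>2) powr s) (ln r)"
      using eventually_at_right_less[of 0]
    proof eventually_elim
      case (elim e)
      interpret differentially_subordinate f F e
        by unfold_locales (use hol F elim in auto)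
      have "norm (F z) powr p \<le> N z powr s" for z
      proof -
        have "norm (F z) powr p = ((norm (F z))\<^sup>2) powr s"
          by (simp add: square_powr s_def)
        also have "\<dots> \<le> N z powr s"
          using s elim by (intro powr_mono2) (auto simp: N_def)
        finally show ?thesis .
      qed
      moreover have "continuous_on left_half (\<lambda>z. norm (F (exp z)) powr p)"
        using p log_pull_holomorphic[OF hol(2)]
        by (intro continuous_on_powr' continuous_intros)
          (auto simp: log_pull_def[abs_def] intro: holomorphic_on_imp_continuous_on)
      ultimately have "line_integral (\<lambda>z. norm (F (exp z)) powr p) (ln r)
          \<le> line_integral (\<lambda>z. N (exp z) powr s) (ln r)"
        by (intro line_integral_mono continuous_powr t)
      also have "\<dots> \<le> K * line_integral (\<lambda>z. X (exp z) powr s) (ln r)"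
        using comparison_concave[OF s _ t] comparison_convex[OF _ t, of s] by (simp add: K_def)
      finally show ?case by (simp add: X_def)
    qed
    have "line_integral (\<lambda>z. norm (F (exp z)) powr p) (ln r)
        \<le> K * line_integral (\<lambda>z. norm (f (exp z)) powr (2 * s)) (ln r)"
      by (rule tendsto_lowerbound[OF tendsto_mult_left[OF line_integral_powr_tendsto[OF hol(1) s t]] ev])
        simp
    then show ?thesis
      using divide_right_mono[of _ _ "2 * pi"] p r
      by (simp add: integral_mean_eq_line_integral f F s_def)
  qed
  ultimately show thesis by (rule that)
qed

section \<open>Membership and norm in the Hardy space\<close>

lemma disc_analyticD:
  assumes "f \<in> disc_analytic"
  shows "f holomorphic_on unit_disc" "continuous_on unit_disc f"
    and "\<And>z. z \<in> unit_disc \<Longrightarrow> (f has_field_derivative deriv f z) (at z)"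
  using assms holomorphic_derivI[of f unit_disc]
  by (auto simp: disc_analytic_def intro: holomorphic_on_imp_continuous_on)

lemma continuous_on_norm_powr_exp:
  assumes "f \<in> disc_analytic" "0 < p"
  shows "continuous_on left_half (\<lambda>z. norm (f (exp z)) powr p)"
  using assms(2) log_pull_holomorphic[OF disc_analyticD(1)[OF assms(1)]]
  by (intro continuous_on_powr' continuous_intros)
    (auto simp: log_pull_def[abs_def] intro: holomorphic_on_imp_continuous_on)

lemma line_integral_const: "line_integral (\<lambda>_. c) t = 2 * pi * c"
  by (simp add: line_integral_def)

lemma integral_mean_nonneg: "0 \<le> integral_mean p f r"
  unfolding integral_mean_def by (rule integral_nonneg_AE) auto

lemma integral_mean_mult:
  "integral_mean p (\<lambda>z. c * f z) r = norm c powr p * integral_mean p f r"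
  by (simp add: integral_mean_def norm_mult powr_mult)

lemma integral_mean_le_combination:
  assumes f: "f \<in> disc_analytic" "0 < p" and g: "g \<in> disc_analytic" "0 < q" and r: "0 < r" "r < 1"
    and le: "\<And>z. z \<in> unit_disc \<Longrightarrow> norm (f z) powr p \<le> a + b * norm (g z) powr q"
  shows "integral_mean p f r \<le> a + b * integral_mean q g r"
proof -
  have "line_integral (\<lambda>z. norm (f (exp z)) powr p) (ln r)
      \<le> line_integral (\<lambda>z. a + b * norm (g (exp z)) powr q) (ln r)"
    using r by (intro line_integral_mono continuous_on_norm_powr_exp f g le exp_left_half
        continuous_on_add continuous_on_mult_left continuous_on_const) auto
  also have "\<dots> = 2 * pi * a + b * line_integral (\<lambda>z. norm (g (exp z)) powr q) (ln r)"
    using r by (subst line_integral_add)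
      (auto simp only: line_integral_const line_integral_cmult ln_less_zero_iff
        intro!: continuous_on_norm_powr_exp g continuous_on_mult_left continuous_on_const)
  finally show ?thesis
    using divide_right_mono[of _ _ "2 * pi"] 
    by (simp add: integral_mean_eq_line_integral f g r field_simps)
qed

lemma at_left_1_eventually:
  "a < 1 \<Longrightarrow> \<forall>\<^sub>F r in at_left (1::real). a < r \<and> r < 1"
  using eventually_at_left_real[of a 1] by (auto elim: eventually_mono)

text \<open>The means increase with the radius, so the limit demanded by \<open>hardy_space\<close>
  is their supremum and boundedness suffices.\<close>

lemma hardy_spaceI:
  assumes f: "f \<in> disc_analytic" and p: "0 < p"
    and M: "\<And>r. 0 < r \<Longrightarrow> r < 1 \<Longrightarrow> integral_mean p f r \<le> M"
  shows "f \<in> hardy_space p"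
proof -
  define S where "S = integral_mean p f ` {0<..<1}"
  have bdd: "bdd_above S" using M by (auto simp: S_def bdd_above_def intro!: exI[of _ M])
  have "(integral_mean p f \<longlongrightarrow> Sup S) (at_left 1)"
  proof (rule order_tendstoI)
    fix a assume "a < Sup S"
    then obtain r0 where r0: "0 < r0" "r0 < 1" "a < integral_mean p f r0"
      using bdd less_cSup_iff[of S a] by (auto simp: S_def)
    have "\<forall>\<^sub>F r in at_left 1. r0 < r \<and> r < 1"
      by (rule at_left_1_eventually[OF r0(2)])
    then show "\<forall>\<^sub>F r in at_left 1. a < integral_mean p f r"
      by eventually_elim (use integral_mean_mono[OF f p, of r0] r0 in \<open>auto intro: less_le_trans\<close>)
  next
    fix a assume a: "Sup S < a"
    show "\<forall>\<^sub>F r in at_left 1. integral_mean p f r < a"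
      using at_left_1_eventually[OF zero_less_one]
    proof eventually_elim
      case (elim r)
      then have "integral_mean p f r \<le> Sup S"
        by (intro cSup_upper bdd) (auto simp: S_def)
      then show ?case using a by simp
    qed
  qed
  then show ?thesis using f by (auto simp: hardy_space_def)
qed

lemma hardy_space_tendsto:
  assumes "f \<in> hardy_space p" and p: "0 < p"
  shows "(integral_mean p f \<longlongrightarrow> hardy_norm p f powr p) (at_left 1)"
proof -
  obtain L where L: "(integral_mean p f \<longlongrightarrow> L) (at_left 1)"
    using assms by (auto simp: hardy_space_def)
  have "0 \<le> L"
    by (rule tendsto_lowerbound[OF L]) (auto simp: integral_mean_nonneg)
  moreover have "Lim (at_left 1) (integral_mean p f) = L"
    using L by (intro tendsto_Lim) auto
  ultimately have "hardy_norm p f powr p = L"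
    using p by (simp add: hardy_norm_def powr_powr)
  then show ?thesis using L by simp
qed

lemma hardy_spaceD:
  assumes f: "f \<in> hardy_space p"
  shows "f \<in> disc_analytic"
    and "0 < p \<Longrightarrow> 0 < r \<Longrightarrow> r < 1 \<Longrightarrow> integral_mean p f r \<le> hardy_norm p f powr p"
proof -
  show d: "f \<in> disc_analytic" using f by (simp add: hardy_space_def)
  assume r: "0 < r" "r < 1" and p: "0 < p"
  show "integral_mean p f r \<le> hardy_norm p f powr p"
  proof (rule tendsto_lowerbound[OF hardy_space_tendsto[OF f p]])
    have "\<forall>\<^sub>F r' in at_left 1. r < r' \<and> r' < 1"
      by (rule at_left_1_eventually[OF r(2)])
    then show "\<forall>\<^sub>F r' in at_left 1. integral_mean p f r \<le> integral_mean p f r'"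
      by eventually_elim (use integral_mean_mono[OF d p] r in auto)
  qed simp
qed

lemma hardy_norm_le:
  assumes f: "f \<in> hardy_space p" and g: "g \<in> disc_analytic" and p: "0 < p" and C: "0 \<le> C"
    and le: "\<And>r. 0 < r \<Longrightarrow> r < 1 \<Longrightarrow> integral_mean p g r \<le> C * integral_mean p f r"
  shows "g \<in> hardy_space p" "hardy_norm p g \<le> C powr (1 / p) * hardy_norm p f"
proof -
  show gs: "g \<in> hardy_space p"
  proof (rule hardy_spaceI[OF g p])
    fix r :: real assume "0 < r" "r < 1"
    then show "integral_mean p g r \<le> C * hardy_norm p f powr p"
      using le[of r] mult_left_mono[OF hardy_spaceD(2)[OF f p, of r] C] by linarith
  qed
  have "hardy_norm p g powr p \<le> C * hardy_norm p f powr p"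
  proof (rule tendsto_le)
    show "((\<lambda>r. C * integral_mean p f r) \<longlongrightarrow> C * hardy_norm p f powr p) (at_left 1)"
      by (intro tendsto_mult_left hardy_space_tendsto f p)
    show "(integral_mean p g \<longlongrightarrow> hardy_norm p g powr p) (at_left 1)"
      by (rule hardy_space_tendsto[OF gs p])
    show "\<forall>\<^sub>F r in at_left 1. integral_mean p g r \<le> C * integral_mean p f r"
      using at_left_1_eventually[OF zero_less_one] by eventually_elim (use le in auto)
  qed simp
  then have "(hardy_norm p g powr p) powr (1 / p) \<le> (C * hardy_norm p f powr p) powr (1 / p)"
    using p by (intro powr_mono2) auto
  then show "hardy_norm p g \<le> C powr (1 / p) * hardy_norm p f"
    using p by (simp add: powr_mult powr_powr) (simp add: hardy_norm_def)
qed

lemma bounded_imp_hardy_space: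
  assumes f: "f \<in> disc_analytic" and p: "0 < p" and B: "\<And>z. z \<in> unit_disc \<Longrightarrow> norm (f z) \<le> B"
  shows "f \<in> hardy_space p"
proof (rule hardy_spaceI[OF f p])
  fix r :: real assume r: "0 < r" "r < 1"
  have "norm (f z) powr p \<le> B powr p + 0 * norm (f z) powr p" if "z \<in> unit_disc" for z
    using B[OF that] p by (simp add: powr_mono2)
  from integral_mean_le_combination[OF f p f p r this] show "integral_mean p f r \<le> B powr p"
    by simp
qed

section \<open>Bounds for point values and derivatives\<close>

text \<open>Cauchy's formula needs the mean of \<open>|f|\<close>. Writing
  \<open>|f| = |f|^(1-q) |f|^q\<close> and estimating the first factor by \<open>S\<close> on the
  circle leaves the mean of \<open>|f|^q\<close>.\<close>

lemma norm_le_sup_powr_integral_mean: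
  assumes f: "f \<in> disc_analytic" and q: "0 < q" "q \<le> 1" and w: "norm w < r" and r: "r < 1"
    and S: "\<And>z. norm z = r \<Longrightarrow> norm (f z) \<le> S"
  shows "norm (f w) \<le> S powr (1 - q) * integral_mean q f r / (r - norm w)"
proof -
  have r0: "0 < r" using w norm_ge_zero[of w] by linarith
  let ?c = "\<lambda>\<theta>. of_real r * cis \<theta>"
  have nc: "norm (?c \<theta>) = r" for \<theta> using r0 by (simp add: norm_mult)
  have "f holomorphic_on cball 0 r"
    by (rule holomorphic_on_subset[OF disc_analyticD(1)[OF f]]) (use r in auto)
  then have "((\<lambda>u. f u / (u - w)) has_contour_integral (2 * of_real pi * \<i> * f w)) (circlepath 0 r)"
    using w by (intro Cauchy_integral_circlepath_simple) auto
  then have I: "((\<lambda>\<theta>. f (?c \<theta>) / (?c \<theta> - w) * r * \<i> * cis \<theta>) has_integral (2 * of_real pi * \<i> * f w))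
      {0..2 * pi}"
    unfolding circlepath_def by (subst (asm) has_contour_integral_part_circlepath_iff) auto
  let ?b = "\<lambda>\<theta>. S powr (1 - q) / (r - norm w) * norm (f (?c \<theta>)) powr q"
  have bd: "norm (f (?c \<theta>) / (?c \<theta> - w) * r * \<i> * cis \<theta>) \<le> ?b \<theta>" for \<theta>
  proof -
    have "r - norm w \<le> norm (?c \<theta> - w)"
      using norm_triangle_ineq2[of "?c \<theta>" w] nc[of \<theta>] by simp
    then have "norm (f (?c \<theta>)) / norm (?c \<theta> - w) * r \<le> norm (f (?c \<theta>)) / (r - norm w) * 1"
      using w r r0 by (intro mult_mono divide_left_mono) (auto intro!: mult_pos_pos)
    also have "\<dots> \<le> (S powr (1 - q) * norm (f (?c \<theta>)) powr q) / (r - norm w) * 1"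
    proof (intro mult_right_mono divide_right_mono)
      let ?a = "norm (f (?c \<theta>))"
      have "?a = ?a powr (1 - q) * ?a powr q"
        by (cases "?a = 0") (auto simp flip: powr_add)
      also have "\<dots> \<le> S powr (1 - q) * ?a powr q"
        using S[OF nc] q by (intro mult_right_mono powr_mono2) auto
      finally show "?a \<le> S powr (1 - q) * ?a powr q" .
    qed (use w in auto)
    finally show ?thesis using r0 by (simp add: norm_mult norm_divide)
  qed
  have int: "(\<lambda>\<theta>. norm (f (?c \<theta>)) powr q) integrable_on {0..2 * pi}"
    using continuous_on_line[OF continuous_on_norm_powr_exp[OF f q(1)], of "ln r"] r r0
    by (intro integrable_continuous_interval) (simp add: exp_log_polar)
  then have intb: "?b integrable_on {0..2 * pi}"
    by (rule integrable_on_mult_right)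
  have "norm (integral {0..2 * pi} (\<lambda>\<theta>. f (?c \<theta>) / (?c \<theta> - w) * r * \<i> * cis \<theta>)) \<le> integral {0..2 * pi} ?b"
    using I by (intro integral_norm_bound_integral intb bd) (auto simp: integrable_on_def)
  also have "integral {0..2 * pi} (\<lambda>\<theta>. f (?c \<theta>) / (?c \<theta> - w) * r * \<i> * cis \<theta>) = 2 * of_real pi * \<i> * f w"
    by (rule integral_unique[OF I])
  also have "integral {0..2 * pi} ?b
      = S powr (1 - q) / (r - norm w) * line_integral (\<lambda>z. norm (f (exp z)) powr q) (ln r)"
    using r0 by (simp add: line_integral_def exp_log_polar)
  also have "\<dots> = 2 * pi * (S powr (1 - q) * integral_mean q f r / (r - norm w))"
    using integral_mean_eq_line_integral[OF f q(1) r0 r] by simp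
  finally have "2 * pi * norm (f w) \<le> 2 * pi * (S powr (1 - q) * integral_mean q f r / (r - norm w))"
    by (simp add: norm_mult)
  then show ?thesis by (subst (asm) mult_le_cancel_left_pos) auto
qed

text \<open>The weighted supremum of a function on a disc is finite a priori, so that the inequality it
  satisfies through Cauchy's formula can be solved for it. This replaces subharmonicity of
  \<open>|f|\<^sup>q\<close> around points other than the centre.\<close>

lemma hardy_growth:
  assumes f: "f \<in> disc_analytic" and q: "0 < q" "q \<le> 1"
    and M: "\<And>r. 0 < r \<Longrightarrow> r < 1 \<Longrightarrow> integral_mean q f r \<le> M"
    and R: "0 < R" "R < 1" and w: "norm w < R"
  shows "norm (f w) \<le> (2 powr (1 / q) * M) powr (1 / q) * (R - norm w) powr (- (1 / q))"
proof -
  \<comment> \<open>With this exponent in the weight, all powers of \<open>d\<close> below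
    cancel.\<close>
  define T where "T = 1 / q"
  have T: "0 < T" "T * q = 1" using q by (auto simp: T_def)
  let ?a = "\<lambda>z. norm (f z) * (R - norm z) powr T"
  have "continuous_on (cball 0 R) f"
    by (rule continuous_on_subset[OF disc_analyticD(2)[OF f]]) (use R in auto)
  then have "continuous_on (cball 0 R) ?a"
    using T by (intro continuous_on_powr' continuous_intros) auto
  then obtain w0 where w0: "norm w0 \<le> R" "\<And>z. norm z \<le> R \<Longrightarrow> ?a z \<le> ?a w0"
    using continuous_attains_sup[of "cball 0 R" ?a] R by (auto simp: dist_norm)
  define A where "A = ?a w0"
  have A: "A \<le> (2 powr T * M) powr T"
  proof (cases "A = 0")
    case False
    then have nz: "norm w0 \<noteq> R" "f w0 \<noteq> 0" by (auto simp: A_def)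
    then have wR: "norm w0 < R" using w0 by simp
    then have Apos: "0 < A" using nz by (simp add: A_def)
    \<comment> \<open>Half of the margin: the circle of radius \<open>R - d\<close> is at distance
      at least \<open>d\<close> from \<open>w0\<close>, and the weight on it is
      \<open>d powr T\<close>.\<close>
    define d where "d = (R - norm w0) / 2"
    have d: "0 < d" "R - norm w0 = 2 * d" using wR by (auto simp: d_def)
    have S: "norm (f z) \<le> A * d powr (- T)" if "norm z = R - d" for z
    proof -
      have "norm (f z) * d powr T \<le> A"
        using w0(2)[of z] that d by (simp add: A_def)
      then show ?thesis using d by (simp add: powr_minus field_simps)
    qed
    have "norm (f w0) \<le> (A * d powr (- T)) powr (1 - q) * integral_mean q f (R - d) / (R - d - norm w0)"
      using S d R by (intro norm_le_sup_powr_integral_mean f q) auto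
    also have "R - d - norm w0 = d" using d by simp
    also have "(A * d powr (- T)) powr (1 - q) * integral_mean q f (R - d) / d
        \<le> (A * d powr (- T)) powr (1 - q) * M / d"
    proof -
      have "0 < R - d" "R - d < 1" using d R norm_ge_zero[of w0] by linarith+
      then show ?thesis using d by (intro divide_right_mono mult_left_mono M) auto
    qed
    also have "(A * d powr (- T)) powr (1 - q) * M / d = A powr (1 - q) * M * d powr (- T)"
    proof -
      have "(d powr (- T)) powr (1 - q) / d = d powr (- T * (1 - q) - 1)"
        using d powr_powr[of d "- T" "1 - q"] powr_diff[of d "- T * (1 - q)" 1] by simp
      also have "- T * (1 - q) - 1 = - T" using T by (simp add: algebra_simps)
      finally show ?thesis by (metis powr_mult mult.assoc mult.commute times_divide_eq_right)
    qed
    finally have "norm (f w0) * (2 * d) powr T \<le> (A powr (1 - q) * M * d powr (- T)) * (2 * d) powr T"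
      by (intro mult_right_mono) auto
    then have "A \<le> A powr (1 - q) * (2 powr T * M)"
      using d by (simp add: A_def powr_mult powr_minus field_simps)
    \<comment> \<open>\<open>A\<close> is positive and finite, so \<open>A powr (1 - q)\<close> can
      be divided out, which leaves a bound for \<open>A powr q\<close>.\<close>
    then have "A powr (q - 1) * A \<le> A powr (q - 1) * (A powr (1 - q) * (2 powr T * M))"
      by (intro mult_left_mono) auto
    also have "\<dots> = 2 powr T * M"
      using Apos powr_add[of A "q - 1" "1 - q"] by (simp add: mult.assoc[symmetric])
    also have "A powr (q - 1) * A = A powr q"
      using Apos powr_add[of A "q - 1" 1] by simp
    finally have "(A powr q) powr T \<le> (2 powr T * M) powr T"
      using T by (intro powr_mono2) auto
    then show ?thesis using Apos T by (simp add: powr_powr mult.commute)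
  qed simp
  have "norm (f w) * (R - norm w) powr T \<le> (2 powr T * M) powr T"
    using w0(2)[of w] w A by (simp add: A_def)
  then show ?thesis
    using w by (simp add: powr_minus field_simps flip: T_def)
qed

text \<open>Growth of \<open>f\<close> near \<open>z\<close> and Cauchy's estimate. The exponent
  \<open>min p 1\<close> treats all \<open>p\<close> at once; the added 1 makes the bound
  inhomogeneous, which is harmless for a statement about geometric growth.\<close>

lemma hardy_deriv_bound:
  assumes p: "0 < p" and z: "z \<in> unit_disc"
  obtains K where "0 \<le> K" "\<And>f. f \<in> hardy_space p \<Longrightarrow>
    norm (deriv f z) \<le> K * (1 + hardy_norm p f powr p) powr (1 / min p 1)"
proof -
  define q where "q = min p 1"
  have q: "0 < q" "q \<le> 1" "q \<le> p" using p by (auto simp: q_def)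
  define T where "T = 1 / q"
  \<comment> \<open>One third of the distance to the circle goes to Cauchy's estimate around
    \<open>z\<close>, one separates the radius \<open>1 - d\<close> from 1, and the last keeps
    \<open>1 - d - norm w\<close> at least \<open>d\<close>.\<close>
  define d where "d = (1 - norm z) / 3"
  have d: "0 < d" "norm z = 1 - 3 * d" using z by (auto simp: d_def field_simps)
  define K where "K = (2 powr T) powr T * d powr (- T) / d"
  have "0 \<le> K" using d by (simp add: K_def)
  moreover have "norm (deriv f z) \<le> K * (1 + hardy_norm p f powr p) powr T"
    if f: "f \<in> hardy_space p" for f
  proof -
    let ?M = "1 + hardy_norm p f powr p"
    note fd = hardy_spaceD(1)[OF f]
    have M: "integral_mean q f r \<le> ?M" if r: "0 < r" "r < 1" for r
    proof -
      have "norm (f z) powr q \<le> 1 + 1 * norm (f z) powr p" for z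
      proof (cases "norm (f z) \<le> 1")
        case True
        then have "norm (f z) powr q \<le> 1"
          using q powr_mono2[of q "norm (f z)" 1] by simp
        then show ?thesis by (simp add: add_increasing2)
      next
        case False
        then have "norm (f z) powr q \<le> norm (f z) powr p" using q by (intro powr_mono) auto
        then show ?thesis by simp
      qed
      then have "integral_mean q f r \<le> 1 + 1 * integral_mean p f r"
        by (intro integral_mean_le_combination fd p q r)
      then show ?thesis using hardy_spaceD(2)[OF f p r] by simp
    qed
    have sub: "cball z d \<subseteq> unit_disc"
    proof
      fix w assume "w \<in> cball z d"
      then have "norm w \<le> norm z + d"
        using norm_triangle_ineq2[of w z] by (simp add: dist_norm norm_minus_commute)
      then show "w \<in> unit_disc" using d by simp
    qed
    have "norm ((deriv ^^ 1) f z) \<le> fact 1 * ((2 powr T * ?M) powr T * d powr (- T)) / d ^ 1"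
    proof (rule Cauchy_inequality)
      show "f holomorphic_on ball z d" "continuous_on (cball z d) f"
        using holomorphic_on_subset[OF disc_analyticD(1)[OF fd]]
          continuous_on_subset[OF disc_analyticD(2)[OF fd]] sub ball_subset_cball[of z d] by blast+
      fix w assume "norm (z - w) = d"
      then have w: "norm w \<le> norm z + d"
        using norm_triangle_ineq2[of w z] by (simp add: norm_minus_commute)
      have "norm (f w) \<le> (2 powr T * ?M) powr T * (1 - d - norm w) powr (- T)"
        unfolding T_def using d w norm_ge_zero[of z]
        by (intro hardy_growth fd q M) linarith+
      also have "\<dots> \<le> (2 powr T * ?M) powr T * d powr (- T)"
        using d w q by (intro mult_left_mono powr_mono2') (auto simp: T_def)
      finally show "norm (f w) \<le> (2 powr T * ?M) powr T * d powr (- T)" .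
    qed (use d in auto)
    also have "fact 1 * ((2 powr T * ?M) powr T * d powr (- T)) / d ^ 1 = K * ?M powr T"
      by (simp add: K_def powr_mult)
    finally show ?thesis by simp
  qed
  ultimately show thesis
    using that unfolding T_def q_def by blast
qed

section \<open>The Volterra operator and its resolvent\<close>

text \<open>Reduces operator identities to the value at 0 and the derivative, where
  \<open>volterra_S g\<close> acts as 0 and as multiplication by \<open>g\<close>. Off the disc both
  functions vanish by convention.\<close>

lemma disc_analytic_eqI:
  assumes f: "f \<in> disc_analytic" and g: "g \<in> disc_analytic" and "f 0 = g 0"
    and D: "\<And>z. z \<in> unit_disc \<Longrightarrow> deriv f z = deriv g z"
  shows "f = g"
proof
  fix z
  have "((\<lambda>z. f z - g z) has_field_derivative 0) (at z within unit_disc)" if "z \<in> unit_disc" for z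
    using DERIV_diff[OF disc_analyticD(3)[OF f that] disc_analyticD(3)[OF g that]] D[OF that]
    by (simp add: has_field_derivative_at_within)
  then obtain c where c: "\<And>z. z \<in> unit_disc \<Longrightarrow> f z - g z = c"
    using has_field_derivative_zero_constant[of unit_disc "\<lambda>z. f z - g z"] by auto
  have "c = 0" using c[of 0] \<open>f 0 = g 0\<close> by simp
  then show "f z = g z"
    using c[of z] f g by (cases "z \<in> unit_disc") (auto simp: disc_analytic_def)
qed

lemma disc_analyticI:
  assumes "\<And>z. z \<in> unit_disc \<Longrightarrow> (f has_field_derivative f' z) (at z)" "\<And>z. z \<notin> unit_disc \<Longrightarrow> f z = 0"
  shows "f \<in> disc_analytic"
proof -
  have "f holomorphic_on unit_disc"
    using assms(1) holomorphic_on_open[OF open_ball] by blast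
  then show ?thesis using assms(2) by (simp add: disc_analytic_def)
qed

lemma volterra_S:
  assumes f: "f \<in> disc_analytic" and g: "g holomorphic_on unit_disc"
  shows "volterra_S g f \<in> disc_analytic" and "volterra_S g f 0 = 0"
    and "\<And>z. z \<in> unit_disc \<Longrightarrow> (volterra_S g f has_field_derivative deriv f z * g z) (at z)"
proof -
  have "(\<lambda>w. deriv f w * g w) holomorphic_on unit_disc"
    by (intro holomorphic_intros holomorphic_deriv disc_analyticD(1)[OF f] g) auto
  then obtain P where P: "\<And>z. z \<in> unit_disc \<Longrightarrow> (P has_field_derivative deriv f z * g z) (at z within unit_disc)"
    using holomorphic_convex_primitive'[OF convex_ball open_ball] by blast
  have V: "volterra_S g f z = P z - P 0" if z: "z \<in> unit_disc" for z
  proof -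
    have "path_image (linepath 0 z) \<subseteq> unit_disc"
      using z by (simp add: closed_segment_subset)
    from contour_integral_primitive[of unit_disc P, OF P valid_path_linepath this]
    show ?thesis using z by (simp add: volterra_S_def contour_integral_unique)
  qed
  show "volterra_S g f 0 = 0" by (simp add: volterra_S_def)
  show D: "(volterra_S g f has_field_derivative deriv f z * g z) (at z)" if z: "z \<in> unit_disc" for z
  proof (rule has_field_derivative_transform_within_open[OF _ open_ball z])
    show "((\<lambda>z. P z - P 0) has_field_derivative deriv f z * g z) (at z)"
      using DERIV_diff[OF P[OF z] DERIV_const] at_within_open[OF z open_ball] by simp
  qed (use z V in \<open>simp_all\<close>)
  show "volterra_S g f \<in> disc_analytic"
    using D by (rule disc_analyticI) (simp_all add: volterra_S_def)
qed

lemma disc_analytic_add: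
  "f \<in> disc_analytic \<Longrightarrow> h \<in> disc_analytic \<Longrightarrow> (\<lambda>z. f z + h z) \<in> disc_analytic"
  by (auto simp: disc_analytic_def intro!: holomorphic_intros)

lemma disc_analytic_cmult: "f \<in> disc_analytic \<Longrightarrow> (\<lambda>z. c * f z) \<in> disc_analytic"
  by (auto simp: disc_analytic_def intro!: holomorphic_intros)

lemma disc_analytic_restrict:
  assumes "f holomorphic_on unit_disc"
  shows "(\<lambda>z. if z \<in> unit_disc then f z else 0) \<in> disc_analytic"
proof -
  have "(\<lambda>z. if z \<in> unit_disc then f z else 0) holomorphic_on unit_disc"
    by (rule holomorphic_transform[OF assms]) simp
  then show ?thesis by (simp add: disc_analytic_def)
qed

lemma deriv_restrict:
  assumes "f holomorphic_on unit_disc" "z \<in> unit_disc"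
  shows "deriv (\<lambda>z. if z \<in> unit_disc then f z else 0) z = deriv f z"
  by (rule complex_derivative_transform_within_open[OF
        disc_analyticD(1)[OF disc_analytic_restrict[OF assms(1)]] assms(1) open_ball assms(2)]) simp

text \<open>The constant is cut off outside the disc to stay in \<open>disc_analytic\<close>, where
  being inverse means equality of total functions.\<close>

definition volterra_resolvent ::
    "complex \<Rightarrow> (complex \<Rightarrow> complex) \<Rightarrow> (complex \<Rightarrow> complex) \<Rightarrow> complex \<Rightarrow> complex" where
  "volterra_resolvent l g h z =
    (if z \<in> unit_disc then h 0 / l else 0) + volterra_S (\<lambda>w. 1 / (l - g w)) h z"

context
  fixes g :: "complex \<Rightarrow> complex" and l :: complex
  assumes g: "g holomorphic_on unit_disc" and l: "l \<notin> g ` unit_disc"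
begin

lemma symbol_neq: "z \<in> unit_disc \<Longrightarrow> g z \<noteq> l"
  using l by blast

lemma holomorphic_recip: "(\<lambda>w. 1 / (l - g w)) holomorphic_on unit_disc"
  using symbol_neq by (intro holomorphic_intros g) auto

lemma volterra_resolvent:
  assumes h: "h \<in> disc_analytic"
  shows "volterra_resolvent l g h \<in> disc_analytic" "volterra_resolvent l g h 0 = h 0 / l"
    "\<And>z. z \<in> unit_disc \<Longrightarrow> deriv (volterra_resolvent l g h) z = deriv h z / (l - g z)"
proof -
  note V = volterra_S[OF h holomorphic_recip]
  show "volterra_resolvent l g h \<in> disc_analytic"
    unfolding volterra_resolvent_def[abs_def]
    by (intro disc_analytic_add disc_analytic_restrict V(1)) auto
  show "volterra_resolvent l g h 0 = h 0 / l"
    using V(2) by (simp add: volterra_resolvent_def)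
  fix z assume z: "z \<in> unit_disc"
  have "(volterra_resolvent l g h has_field_derivative deriv h z * (1 / (l - g z))) (at z)"
  proof (rule has_field_derivative_transform_within_open[OF _ open_ball z])
    show "((\<lambda>z. h 0 / l + volterra_S (\<lambda>w. 1 / (l - g w)) h z) has_field_derivative
        deriv h z * (1 / (l - g z))) (at z)"
      using DERIV_add[OF DERIV_const V(3)[OF z]] by simp
  qed (use z in \<open>auto simp: volterra_resolvent_def\<close>)
  from DERIV_imp_deriv[OF this] show "deriv (volterra_resolvent l g h) z = deriv h z / (l - g z)"
    by simp
qed

lemma volterra_resolvent_inverse:
  assumes f: "f \<in> disc_analytic" and l0: "l \<noteq> 0"
  shows "volterra_resolvent l g (\<lambda>z. l * f z - volterra_S g f z) = f"
    and "(\<lambda>z. l * volterra_resolvent l g f z - volterra_S g (volterra_resolvent l g f) z) = f"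
proof -
  have k: "(\<lambda>z. l * f z - volterra_S g f z) \<in> disc_analytic"
    "\<And>z. z \<in> unit_disc \<Longrightarrow> deriv (\<lambda>z. l * f z - volterra_S g f z) z = (l - g z) * deriv f z"
    if f: "f \<in> disc_analytic" for f
  proof -
    have D: "((\<lambda>z. l * f z - volterra_S g f z) has_field_derivative (l - g z) * deriv f z) (at z)"
      if "z \<in> unit_disc" for z
      using DERIV_diff[OF DERIV_cmult[OF disc_analyticD(3)[OF f that]] volterra_S(3)[OF f g that]]
      by (simp add: algebra_simps)
    show "(\<lambda>z. l * f z - volterra_S g f z) \<in> disc_analytic"
      by (rule disc_analyticI[OF D]) (use f in \<open>auto simp: disc_analytic_def volterra_S_def\<close>)
    show "\<And>z. z \<in> unit_disc \<Longrightarrow> deriv (\<lambda>z. l * f z - volterra_S g f z) z = (l - g z) * deriv f z"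
      using D by (rule DERIV_imp_deriv)
  qed
  note R = volterra_resolvent
  show "volterra_resolvent l g (\<lambda>z. l * f z - volterra_S g f z) = f"
    using symbol_neq l0 by (intro disc_analytic_eqI f R k)
      (auto simp: R(2,3)[OF k(1)[OF f]] k(2)[OF f] volterra_S(2)[OF f g])
  show "(\<lambda>z. l * volterra_resolvent l g f z - volterra_S g (volterra_resolvent l g f) z) = f"
    using symbol_neq l0 by (intro disc_analytic_eqI f R k)
      (auto simp: R(2,3)[OF f] k(2)[OF R(1)[OF f]] volterra_S(2)[OF R(1)[OF f] g])
qed

lemma volterra_resolvent_linear:
  assumes f: "f \<in> disc_analytic" and h: "h \<in> disc_analytic"
  shows "volterra_resolvent l g (\<lambda>z. f z + h z) = (\<lambda>z. volterra_resolvent l g f z + volterra_resolvent l g h z)"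
    and "volterra_resolvent l g (\<lambda>z. c * f z) = (\<lambda>z. c * volterra_resolvent l g f z)"
proof -
  note R = volterra_resolvent
  have add: "deriv (\<lambda>z. u z + v z) z = deriv u z + deriv v z"
    if "u \<in> disc_analytic" "v \<in> disc_analytic" "z \<in> unit_disc" for u v z
    using DERIV_add[OF disc_analyticD(3)[OF that(1,3)] disc_analyticD(3)[OF that(2,3)]]
    by (rule DERIV_imp_deriv)
  have mult: "deriv (\<lambda>z. c * u z) z = c * deriv u z"
    if "u \<in> disc_analytic" "z \<in> unit_disc" for u z
    using DERIV_cmult[OF disc_analyticD(3)[OF that]] by (rule DERIV_imp_deriv)
  show "volterra_resolvent l g (\<lambda>z. f z + h z) = (\<lambda>z. volterra_resolvent l g f z + volterra_resolvent l g h z)"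
  proof (rule disc_analytic_eqI)
    fix z assume z: "z \<in> unit_disc"
    show "deriv (volterra_resolvent l g (\<lambda>z. f z + h z)) z
        = deriv (\<lambda>z. volterra_resolvent l g f z + volterra_resolvent l g h z) z"
      using z by (simp only: add R disc_analytic_add f h add_divide_distrib)
  qed (simp_all only: R disc_analytic_add f h add_divide_distrib)
  show "volterra_resolvent l g (\<lambda>z. c * f z) = (\<lambda>z. c * volterra_resolvent l g f z)"
  proof (rule disc_analytic_eqI)
    fix z assume z: "z \<in> unit_disc"
    show "deriv (volterra_resolvent l g (\<lambda>z. c * f z)) z = deriv (\<lambda>z. c * volterra_resolvent l g f z) z"
      using z by (simp only: mult R disc_analytic_cmult f times_divide_eq_right)
  qed (simp_all only: R disc_analytic_cmult f times_divide_eq_right)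
qed

end

text \<open>A substitute for the triangle inequality, with a crude constant valid on both sides of
  \<open>p = 1\<close>.\<close>

lemma powr_add_le:
  fixes a b p :: real
  assumes "0 \<le> a" "0 \<le> b" "0 \<le> p"
  shows "(a + b) powr p \<le> 2 powr p * (a powr p + b powr p)"
proof -
  have "(a + b) powr p \<le> (2 * max a b) powr p"
    using assms by (intro powr_mono2) auto
  also have "\<dots> = 2 powr p * max a b powr p"
    using assms by (simp add: powr_mult)
  also have "\<dots> \<le> 2 powr p * (a powr p + b powr p)"
    by (intro mult_left_mono) (auto simp: max_def)
  finally show ?thesis .
qed

lemma volterra_resolvent_bounded:
  assumes g: "g holomorphic_on unit_disc" and p: "0 < p" and l: "l \<noteq> 0"
    and d: "0 < d" "\<And>z. z \<in> unit_disc \<Longrightarrow> d \<le> norm (l - g z)"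
  shows "hardy_bounded_operator p (volterra_resolvent l g)"
proof -
  have ne: "l \<notin> g ` unit_disc" using d by force
  note R = volterra_resolvent[OF g ne] and lin = volterra_resolvent_linear[OF g ne]
  obtain K where K: "0 \<le> K"
    "\<And>f F r. f \<in> disc_analytic \<Longrightarrow> F \<in> disc_analytic \<Longrightarrow> F 0 = 0 \<Longrightarrow>
      (\<And>z. z \<in> unit_disc \<Longrightarrow> norm (deriv F z) \<le> norm (deriv f z)) \<Longrightarrow> 0 < r \<Longrightarrow> r < 1 \<Longrightarrow>
      integral_mean p F r \<le> K * integral_mean p f r"
    using integral_mean_subordinate[OF p] by blast
  define C where "C = 2 powr p * ((1 / norm l) powr p + K * (1 / d) powr p)"
  have C: "0 \<le> C" using K by (simp add: C_def)
  have le: "integral_mean p (volterra_resolvent l g h) r \<le> C * integral_mean p h r"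
    if h: "h \<in> disc_analytic" and r: "0 < r" "r < 1" for h r
  proof -
    let ?V = "volterra_S (\<lambda>w. 1 / (l - g w)) h"
    note V = volterra_S[OF h holomorphic_recip[OF g ne]]
    \<comment> \<open>The derivative of \<open>?V\<close> is that of \<open>h\<close> divided by
      \<open>l - g\<close>, so \<open>?V\<close> is subordinate to \<open>h / d\<close>.\<close>
    have "integral_mean p ?V r \<le> K * integral_mean p (\<lambda>z. of_real (1 / d) * h z) r"
    proof (rule K(2)[OF disc_analytic_cmult[OF h] V(1,2) _ r])
      fix z assume z: "z \<in> unit_disc"
      have "norm (deriv ?V z) = norm (deriv h z) / norm (l - g z)"
        using DERIV_imp_deriv[OF V(3)[OF z]] by (simp add: norm_divide norm_mult)
      also have "\<dots> \<le> norm (deriv h z) / d"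
        using d(1) d(2)[OF z] by (intro divide_left_mono mult_pos_pos) auto
      also have "\<dots> = norm (deriv (\<lambda>z. of_real (1 / d) * h z) z)"
        using DERIV_imp_deriv[OF DERIV_cmult[OF disc_analyticD(3)[OF h z]], of "of_real (1 / d)"] d(1)
        by (simp add: norm_mult norm_divide)
      finally show "norm (deriv ?V z) \<le> norm (deriv (\<lambda>z. of_real (1 / d) * h z) z)" .
    qed
    also have "\<dots> = K * (1 / d) powr p * integral_mean p h r"
      using d(1) integral_mean_mult[of p "of_real (1 / d)" h r]
      by (simp only: norm_of_real) simp
    finally have V_le: "integral_mean p ?V r \<le> K * (1 / d) powr p * integral_mean p h r" .
    have "norm (volterra_resolvent l g h z) powr p
        \<le> 2 powr p * (norm (h 0 / l) powr p) + 2 powr p * norm (?V z) powr p" if "z \<in> unit_disc" for z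
    proof -
      have "norm (volterra_resolvent l g h z) powr p \<le> (norm (h 0 / l) + norm (?V z)) powr p"
        using p that by (intro powr_mono2) (auto simp: volterra_resolvent_def norm_triangle_ineq)
      also have "\<dots> \<le> 2 powr p * (norm (h 0 / l) powr p + norm (?V z) powr p)"
        using p by (intro powr_add_le) auto
      finally show ?thesis by (simp add: distrib_left)
    qed
    then have "integral_mean p (volterra_resolvent l g h) r
        \<le> 2 powr p * (norm (h 0 / l) powr p) + 2 powr p * integral_mean p ?V r"
      by (intro integral_mean_le_combination R h V p r)
    also have "norm (h 0 / l) powr p = (1 / norm l) powr p * norm (h 0) powr p"
      by (simp add: norm_divide flip: powr_mult)
    also have "2 powr p * ((1 / norm l) powr p * norm (h 0) powr p) + 2 powr p * integral_mean p ?V r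
      \<le> 2 powr p * ((1 / norm l) powr p * integral_mean p h r)
        + 2 powr p * (K * (1 / d) powr p * integral_mean p h r)"
      using integral_mean_ge_center[OF h p r] V_le by (intro add_mono mult_left_mono) auto
    finally show ?thesis by (simp add: C_def algebra_simps)
  qed
  show ?thesis
    unfolding hardy_bounded_operator_def
  proof (intro conjI ballI allI exI)
    fix f assume f: "f \<in> hardy_space p"
    note fd = hardy_spaceD(1)[OF f]
    show "volterra_resolvent l g f \<in> hardy_space p"
      "hardy_norm p (volterra_resolvent l g f) \<le> C powr (1 / p) * hardy_norm p f"
      by (rule hardy_norm_le[OF f R(1)[OF fd] p C le[OF fd]]; assumption)+
    show "volterra_resolvent l g (\<lambda>z. f z + h z) = (\<lambda>z. volterra_resolvent l g f z + volterra_resolvent l g h z)"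
      if "h \<in> hardy_space p" for h
      by (rule lin(1)[OF fd hardy_spaceD(1)[OF that]])
    show "volterra_resolvent l g (\<lambda>z. c * f z) = (\<lambda>z. c * volterra_resolvent l g f z)" for c
      by (rule lin(2)[OF fd fd])
  qed
qed

section \<open>The spectrum\<close>

text \<open>\<open>K\<close> is lost in the comparison of growth rates. It will be the constant of
  the derivative bound, which depends on the point of the disc, while \<open>D\<close> does
  not.\<close>

lemma power_le_imp_base_le:
  fixes a D K :: real
  assumes "0 < D" "\<And>n. a ^ n \<le> K * D ^ n"
  shows "a \<le> D"
proof (rule ccontr)
  assume "\<not> a \<le> D"
  then have "1 < a / D" using assms(1) by simp
  then obtain n where "K < (a / D) ^ n" using real_arch_pow by blast
  then show False using assms(2)[of n] assms(1) by (simp add: power_divide field_simps)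
qed

text \<open>Iterating the resolvent on the identity function produces functions whose derivatives are the
  powers of \<open>1 / (l - g)\<close>, while point evaluation of derivatives is bounded on the Hardy space.\<close>

lemma symbol_bounded_away:
  assumes g: "g holomorphic_on unit_disc" and p: "0 < p" and R: "hardy_bounded_operator p R"
    and inv: "\<And>f. f \<in> hardy_space p \<Longrightarrow> (\<lambda>z. l * R f z - volterra_S g (R f) z) = f"
  shows "l \<notin> closure (g ` unit_disc)"
proof -
  define e1 where "e1 = (\<lambda>z::complex. if z \<in> unit_disc then z else 0)"
  have e1: "e1 \<in> disc_analytic" "\<And>z. z \<in> unit_disc \<Longrightarrow> deriv e1 z = 1"
    unfolding e1_def using disc_analytic_restrict[of "\<lambda>z. z"] deriv_restrict[of "\<lambda>z. z"]
    by (auto simp: deriv_ident)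
  have e1h: "e1 \<in> hardy_space p"
    by (rule bounded_imp_hardy_space[OF e1(1) p, of 1]) (auto simp: e1_def)
  have Rh: "R f \<in> hardy_space p" if "f \<in> hardy_space p" for f
    using R that by (auto simp: hardy_bounded_operator_def)
  obtain C0 where C0: "\<And>f. f \<in> hardy_space p \<Longrightarrow> hardy_norm p (R f) \<le> C0 * hardy_norm p f"
    using R unfolding hardy_bounded_operator_def by blast
  \<comment> \<open>At least 1, so that powers of \<open>C\<close> also absorb the 1 added in the
    derivative bound.\<close>
  define C where "C = max C0 1"
  have norm_nonneg: "0 \<le> hardy_norm p f" for f by (simp add: hardy_norm_def)
  have C: "1 \<le> C" "hardy_norm p (R f) \<le> C * hardy_norm p f" if "f \<in> hardy_space p" for f
    using C0[OF that] mult_right_mono[OF _ norm_nonneg, of C0 C f] by (auto simp: C_def)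
  have C1: "1 \<le> C" by (simp add: C_def)
  define h where "h n = (R ^^ n) e1" for n
  have hh: "h n \<in> hardy_space p" for n
    by (induction n) (auto simp: h_def e1h Rh)
  have hn: "hardy_norm p (h n) \<le> C ^ n * hardy_norm p e1" for n
  proof (induction n)
    case (Suc n)
    have "hardy_norm p (h (Suc n)) \<le> C * hardy_norm p (h n)"
      using C(2)[OF hh[of n]] by (simp add: h_def)
    also have "\<dots> \<le> C * (C ^ n * hardy_norm p e1)"
      using Suc C1 by (intro mult_left_mono) auto
    finally show ?case by simp
  qed (simp add: h_def)
  have hd: "(l - g z) * deriv (h (Suc n)) z = deriv (h n) z" if z: "z \<in> unit_disc" for n z
  proof -
    note d = hardy_spaceD(1)[OF hh[of "Suc n"]]
    have "((\<lambda>z. l * h (Suc n) z - volterra_S g (h (Suc n)) z) has_field_derivative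
        l * deriv (h (Suc n)) z - deriv (h (Suc n)) z * g z) (at z)"
      by (intro DERIV_diff DERIV_cmult disc_analyticD(3)[OF d z] volterra_S(3)[OF d g z])
    moreover have "(\<lambda>z. l * h (Suc n) z - volterra_S g (h (Suc n)) z) = h n"
      using inv[OF hh[of n]] by (simp add: h_def)
    ultimately show ?thesis by (simp add: DERIV_imp_deriv algebra_simps)
  qed
  have hp: "(l - g z) ^ n * deriv (h n) z = 1" if z: "z \<in> unit_disc" for n z
  proof (induction n)
    case (Suc n)
    have "(l - g z) ^ Suc n * deriv (h (Suc n)) z = (l - g z) ^ n * ((l - g z) * deriv (h (Suc n)) z)"
      by simp
    then show ?case using Suc hd[OF z, of n] by simp
  qed (simp add: h_def e1(2)[OF z])
  define T where "T = 1 / min p 1"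
  have T: "0 < T" using p by (simp add: T_def)
  \<comment> \<open>The growth rate of the derivative bound: the norms of \<open>h n\<close> grow
    like \<open>C ^ n\<close>, and the bound raises them to the powers \<open>p\<close> and
    \<open>T\<close>.\<close>
  define D where "D = C powr (p * T)"
  have D: "0 < D" using C1 by (simp add: D_def)
  have away: "1 / D \<le> norm (l - g z)" if z: "z \<in> unit_disc" for z
  proof -
    obtain K where K: "0 \<le> K" "\<And>f. f \<in> hardy_space p \<Longrightarrow>
        norm (deriv f z) \<le> K * (1 + hardy_norm p f powr p) powr T"
      using hardy_deriv_bound[OF p z] unfolding T_def by blast
    \<comment> \<open>The case \<open>n = 1\<close> already shows that \<open>g\<close> omits the
      value \<open>l\<close>.\<close>
    have nz: "l - g z \<noteq> 0" using hp[OF z, of 1] by auto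
    have "(1 / norm (l - g z)) ^ n \<le> K * (1 + hardy_norm p e1 powr p) powr T * D ^ n" for n
    proof -
      have "norm ((l - g z) ^ n) * norm (deriv (h n) z) = 1"
        using hp[OF z, of n] by (metis norm_mult norm_one)
      then have "(1 / norm (l - g z)) ^ n = norm (deriv (h n) z)"
        using nz by (simp add: norm_power power_divide field_simps)
      also have "\<dots> \<le> K * (1 + hardy_norm p (h n) powr p) powr T"
        by (rule K(2)[OF hh])
      also have "\<dots> \<le> K * ((C ^ n) powr p * (1 + hardy_norm p e1 powr p)) powr T"
      proof (intro mult_left_mono powr_mono2 K)
        have "hardy_norm p (h n) powr p \<le> (C ^ n * hardy_norm p e1) powr p"
          using hn p norm_nonneg by (intro powr_mono2) auto
        moreover have "1 \<le> (C ^ n) powr p"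
          using C1 p by (simp add: ge_one_powr_ge_zero one_le_power)
        ultimately show "1 + hardy_norm p (h n) powr p \<le> (C ^ n) powr p * (1 + hardy_norm p e1 powr p)"
          using C1 by (simp add: powr_mult distrib_left)
      qed (use T in auto)
      also have "((C ^ n) powr p * (1 + hardy_norm p e1 powr p)) powr T
          = (1 + hardy_norm p e1 powr p) powr T * D ^ n"
      proof -
        have "((C ^ n) powr p) powr T = D ^ n"
          using C1 by (simp add: D_def powr_powr powr_power flip: powr_realpow)
            (simp add: mult.commute mult.left_commute)
        then show ?thesis by (simp add: powr_mult)
      qed
      finally show ?thesis by (simp add: mult.assoc)
    qed
    then have "1 / norm (l - g z) \<le> D" by (rule power_le_imp_base_le[OF D])
    then show ?thesis using nz D by (simp add: field_simps)
  qed
  show ?thesis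
  proof
    assume "l \<in> closure (g ` unit_disc)"
    then obtain z where "z \<in> unit_disc" "dist (g z) l < 1 / D"
      using D by (auto simp: closure_approachable dest!: spec[of _ "1 / D"])
    then show False using away[of z] by (simp add: dist_norm norm_minus_commute)
  qed
qed

lemma zero_in_hardy_spectrum_volterra:
  assumes g: "g holomorphic_on unit_disc" and p: "0 < p"
  shows "0 \<in> hardy_spectrum p (volterra_S g)"
proof -
  define e0 where "e0 = (\<lambda>z::complex. if z \<in> unit_disc then 1 else 0 :: complex)"
  have "e0 \<in> disc_analytic"
    unfolding e0_def by (rule disc_analytic_restrict) simp
  then have e0: "e0 \<in> hardy_space p"
    by (rule bounded_imp_hardy_space[OF _ p, of _ 1]) (auto simp: e0_def)
  have False if R: "hardy_bounded_operator p R" and "(\<lambda>z. 0 * R e0 z - volterra_S g (R e0) z) = e0" for R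
  proof -
    have "R e0 \<in> disc_analytic"
      using R e0 hardy_spaceD(1) by (auto simp: hardy_bounded_operator_def)
    then show False
      using fun_cong[OF that(2), of 0] volterra_S(2)[OF _ g, of "R e0"] by (simp add: e0_def)
  qed
  then show ?thesis using e0 unfolding hardy_spectrum_def by blast
qed

theorem proposition3:
  fixes g :: "complex \<Rightarrow> complex" and p :: real
  assumes "g holomorphic_on unit_disc"
    and "0 < p"
    and "hardy_bounded_operator p (volterra_S g)"
  shows "hardy_spectrum p (volterra_S g) = {0} \<union> closure (g ` unit_disc)"
proof (intro equalityI subsetI)
  fix l assume l: "l \<in> hardy_spectrum p (volterra_S g)"
  show "l \<in> {0} \<union> closure (g ` unit_disc)"
  proof (rule ccontr)
    assume n: "l \<notin> {0} \<union> closure (g ` unit_disc)"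
    then obtain d where d: "0 < d" "\<And>z. z \<in> unit_disc \<Longrightarrow> d \<le> norm (l - g z)"
      by (auto simp: closure_approachable dist_norm norm_minus_commute not_less)
    then have ne: "l \<notin> g ` unit_disc" by force
    have "hardy_bounded_operator p (volterra_resolvent l g)"
      using n d by (intro volterra_resolvent_bounded assms) auto
    moreover have "volterra_resolvent l g (\<lambda>z. l * f z - volterra_S g f z) = f"
      "(\<lambda>z. l * volterra_resolvent l g f z - volterra_S g (volterra_resolvent l g f) z) = f"
      if "f \<in> hardy_space p" for f
      using volterra_resolvent_inverse[OF assms(1) ne hardy_spaceD(1)[OF that]] n by auto
    ultimately show False using l unfolding hardy_spectrum_def by blast
  qed
next
  fix l assume "l \<in> {0} \<union> closure (g ` unit_disc)"
  then show "l \<in> hardy_spectrum p (volterra_S g)"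
    using zero_in_hardy_spectrum_volterra[OF assms(1,2)] symbol_bounded_away[OF assms(1,2)]
    unfolding hardy_spectrum_def by blast
qed

end
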